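(* Let $d,n\ge 1$. If $\varphi:\mathcal T_d\to M_n$ is a pure unital completely positive map, then $\varphi$ has a unique completely positive extension to $M_d$; that is, there exists exactly one completely positive map $\tilde\varphi:M_d\to M_n$ with $\tilde\varphi|_{\mathcal T_d}=\varphi$.
   Context: $M_n=M_n(\mathbb C)$. $\mathcal T_d\subseteq M_d$ is the operator system of all $d\times d$ Toeplitz matrices $[a_{i-j}]_{i,j=0}^{d-1}$, $a_k\in\mathbb C$. CP means completely positive. For CP maps $\psi,\varphi:\mathcal T_d\to M_n$ write $\psi\le_{\mathrm{cp}}\varphi$ if $\varphi-\psi$ is CP. A nonzero CP map $\varphi$ is pure if every CP map $\psi$ with $\psi\le_{\mathrm{cp}}\varphi$ is of the form $\psi=t\varphi$ for some $t\in[0,1]$. *)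

theory Defs
  imports "Jordan_Normal_Form.Matrix" "HOL-Library.FuncSet"
begin

definition toeplitz :: "nat \<Rightarrow> complex mat set" where
  "toeplitz d = {mat d d (\<lambda>(i, j). a (int i - int j)) | a :: int \<Rightarrow> complex. True}"

(* The order on complex is that of Complex_Order: 0 \<le> z says that z is real and nonnegative.
   Hence the condition on the quadratic form includes that A is Hermitian. *)
definition pos_semidef :: "nat \<Rightarrow> complex mat \<Rightarrow> bool" where
  "pos_semidef m A \<longleftrightarrow> A \<in> carrier_mat m m \<and> (\<forall>v \<in> carrier_vec m. 0 \<le> (A *\<^sub>v v) \<bullet>c v)"

(* An element of M_k(S), with S a space of d x d matrices, is given by its entries X i j in S,
   for i, j < k; block_mat k d X is the same element seen in M_k(M_d) = M_{kd}. *)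
definition block_mat :: "nat \<Rightarrow> nat \<Rightarrow> (nat \<Rightarrow> nat \<Rightarrow> complex mat) \<Rightarrow> complex mat" where
  "block_mat k d X =
     mat (k * d) (k * d) (\<lambda>(p, q). X (p div d) (q div d) $$ (p mod d, q mod d))"

(* Maps S \<rightarrow> M_n are HOL functions of which only the values on S matter. *)
definition linear_map_on :: "complex mat set \<Rightarrow> nat \<Rightarrow> (complex mat \<Rightarrow> complex mat) \<Rightarrow> bool" where
  "linear_map_on S n \<phi> \<longleftrightarrow>
     (\<forall>X \<in> S. \<phi> X \<in> carrier_mat n n) \<and>
     (\<forall>X \<in> S. \<forall>Y \<in> S. \<phi> (X + Y) = \<phi> X + \<phi> Y) \<and>
     (\<forall>c. \<forall>X \<in> S. \<phi> (c \<cdot>\<^sub>m X) = c \<cdot>\<^sub>m \<phi> X)"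

definition completely_positive ::
    "nat \<Rightarrow> complex mat set \<Rightarrow> nat \<Rightarrow> (complex mat \<Rightarrow> complex mat) \<Rightarrow> bool" where
  "completely_positive d S n \<phi> \<longleftrightarrow>
     linear_map_on S n \<phi> \<and>
     (\<forall>k X. (\<forall>i<k. \<forall>j<k. X i j \<in> S) \<longrightarrow> pos_semidef (k * d) (block_mat k d X) \<longrightarrow>
        pos_semidef (k * n) (block_mat k n (\<lambda>i j. \<phi> (X i j))))"

definition cp_le ::
    "nat \<Rightarrow> complex mat set \<Rightarrow> nat \<Rightarrow> (complex mat \<Rightarrow> complex mat) \<Rightarrow>
     (complex mat \<Rightarrow> complex mat) \<Rightarrow> bool" where
  "cp_le d S n \<psi> \<phi> \<longleftrightarrow> completely_positive d S n (\<lambda>X. \<phi> X - \<psi> X)"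

definition pure_cp ::
    "nat \<Rightarrow> complex mat set \<Rightarrow> nat \<Rightarrow> (complex mat \<Rightarrow> complex mat) \<Rightarrow> bool" where
  "pure_cp d S n \<phi> \<longleftrightarrow>
     completely_positive d S n \<phi> \<and>
     (\<exists>X \<in> S. \<phi> X \<noteq> 0\<^sub>m n n) \<and>
     (\<forall>\<psi>. completely_positive d S n \<psi> \<longrightarrow> cp_le d S n \<psi> \<phi> \<longrightarrow>
        (\<exists>t \<in> {0..1 :: real}. \<forall>X \<in> S. \<psi> X = complex_of_real t \<cdot>\<^sub>m \<phi> X))"

end

theory Submission
  imports Defs "HOL-Analysis.Function_Topology"
begin

text \<open>Completely positive maps \<open>M\<^sub>d \<rightarrow> M\<^sub>n\<close> correspond to positive semidefinite Choi kernels on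
  \<open>{..<d} \<times> {..<n}\<close>, and the restriction to Toeplitz matrices only sees the sums of the kernel
  along the diagonals \<open>i - j = k\<close>. An extension exists by least squares over the cone of
  positive semidefinite kernels: the residual is dual to the cone, so it is a positive block
  Toeplitz matrix, on which complete positivity forces it to vanish.

  For uniqueness, let \<open>C\<close> be the average of two Choi kernels of extensions. If \<open>w w\<^sup>*\<close> is dominated by a
  multiple of \<open>C\<close>, then purity makes its restriction proportional to \<open>\<phi>\<close>. Such vectors form a
  subspace \<open>W\<close>, so by polarization the restriction of \<open>w u\<^sup>*\<close> is a multiple of \<open>\<phi>\<close> for all
  \<open>w, u\<close> in \<open>W\<close>. Fixing \<open>u \<noteq> 0\<close>, some \<open>(w - c u) u\<^sup>*\<close> restricts to zero. The diagonal sums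
  of \<open>v u\<^sup>*\<close> are the coefficients of products of Laurent polynomials, which have no zero divisors,
  so \<open>w = c u\<close>. Hence \<open>W\<close> is one-dimensional, and as it contains the columns of both kernels, these
  are proportional to \<open>u u\<^sup>*\<close> and equal.\<close>

section \<open>Positive semidefinite kernels\<close>

text \<open>Linear in \<open>u\<close>, conjugate-linear in \<open>v\<close>. Kernels on an
  arbitrary index set replace matrices so that the indices of block matrices can be pairs instead of
  numbers \<open>i * d + a\<close>. Values off \<open>S\<close> do not matter.\<close>

definition sesq :: "'a set \<Rightarrow> ('a \<Rightarrow> 'a \<Rightarrow> complex) \<Rightarrow> ('a \<Rightarrow> complex) \<Rightarrow> ('a \<Rightarrow> complex) \<Rightarrow> complex" where
  "sesq S C u v = (\<Sum>p\<in>S. \<Sum>q\<in>S. C p q * u q * cnj (v p))"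

definition psd_kernel :: "'a set \<Rightarrow> ('a \<Rightarrow> 'a \<Rightarrow> complex) \<Rightarrow> bool" where
  "psd_kernel S C \<longleftrightarrow> (\<forall>v. 0 \<le> sesq S C v v)"

lemma sesq_add_left: "sesq S C (\<lambda>p. u p + u' p) v = sesq S C u v + sesq S C u' v"
  by (simp add: sesq_def algebra_simps sum.distrib)

lemma sesq_add_right: "sesq S C u (\<lambda>p. v p + v' p) = sesq S C u v + sesq S C u v'"
  by (simp add: sesq_def algebra_simps sum.distrib)

lemma sesq_scale_left: "sesq S C (\<lambda>p. c * u p) v = c * sesq S C u v"
  by (simp add: sesq_def sum_distrib_left mult_ac)

lemma sesq_scale_right: "sesq S C u (\<lambda>p. c * v p) = cnj c * sesq S C u v"
  by (simp add: sesq_def sum_distrib_left mult_ac)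

lemma sesq_add_kernel: "sesq S (\<lambda>p q. C p q + D p q) u v = sesq S C u v + sesq S D u v"
  by (simp add: sesq_def algebra_simps sum.distrib)

lemma sesq_diff_kernel: "sesq S (\<lambda>p q. C p q - D p q) u v = sesq S C u v - sesq S D u v"
  by (simp add: sesq_def algebra_simps sum_subtractf)

lemma sesq_scale_kernel: "sesq S (\<lambda>p q. c * C p q) u v = c * sesq S C u v"
  by (simp add: sesq_def sum_distrib_left mult_ac)

lemma sesq_cong:
  assumes "\<And>p q. p \<in> S \<Longrightarrow> q \<in> S \<Longrightarrow> C p q = D p q"
    and "\<And>p. p \<in> S \<Longrightarrow> u p = u' p" and "\<And>p. p \<in> S \<Longrightarrow> v p = v' p"
  shows "sesq S C u v = sesq S D u' v'"
  unfolding sesq_def using assms by (intro sum.cong refl) auto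

text \<open>Indicator functions \<open>of_bool (x = p)\<close> serve as the standard basis vectors
  throughout.\<close>

lemma sesq_unit_right:
  assumes "finite S" "p \<in> S"
  shows "sesq S C u (\<lambda>x. of_bool (x = p)) = (\<Sum>q\<in>S. C p q * u q)"
proof -
  have "sesq S C u (\<lambda>x. of_bool (x = p)) = (\<Sum>x\<in>S. if x = p then \<Sum>q\<in>S. C p q * u q else 0)"
    unfolding sesq_def by (intro sum.cong) auto
  then show ?thesis using assms by simp
qed

lemma sesq_units:
  assumes "finite S" "p \<in> S" "q \<in> S"
  shows "sesq S C (\<lambda>x. of_bool (x = q)) (\<lambda>x. of_bool (x = p)) = C p q"
  using assms unfolding sesq_unit_right[OF assms(1,2)]
  by (simp add: of_bool_def if_distrib cong: if_cong)

lemma psd_kernelD: "psd_kernel S C \<Longrightarrow> 0 \<le> sesq S C v v"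
  by (simp add: psd_kernel_def)

lemma psd_kernel_cong:
  assumes "\<And>p q. p \<in> S \<Longrightarrow> q \<in> S \<Longrightarrow> C p q = D p q"
  shows "psd_kernel S C \<longleftrightarrow> psd_kernel S D"
  unfolding psd_kernel_def using sesq_cong[of S C D] assms by metis

lemma psd_kernel_add: "psd_kernel S C \<Longrightarrow> psd_kernel S D \<Longrightarrow> psd_kernel S (\<lambda>p q. C p q + D p q)"
  by (simp add: psd_kernel_def sesq_add_kernel)

lemma psd_kernel_scale:
  assumes "psd_kernel S C" "0 \<le> (r::real)"
  shows "psd_kernel S (\<lambda>p q. complex_of_real r * C p q)"
  unfolding psd_kernel_def sesq_scale_kernel
  using assms by (auto simp: psd_kernel_def less_eq_complex_def)

lemma sesq_rank_one:
  "sesq S (\<lambda>p q. w p * cnj (w q)) v v =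
     complex_of_real ((cmod (\<Sum>p\<in>S. w p * cnj (v p)))\<^sup>2)"
proof -
  have "sesq S (\<lambda>p q. w p * cnj (w q)) v v =
      (\<Sum>p\<in>S. w p * cnj (v p)) * (\<Sum>q\<in>S. cnj (w q) * v q)"
    unfolding sesq_def sum_product by (intro sum.cong) (simp_all add: mult_ac)
  also have "(\<Sum>q\<in>S. cnj (w q) * v q) = cnj (\<Sum>p\<in>S. w p * cnj (v p))"
    by simp
  finally show ?thesis by (simp only: complex_norm_square)
qed

lemma psd_kernel_rank_one: "psd_kernel S (\<lambda>p q. w p * cnj (w q))"
  by (simp add: psd_kernel_def sesq_rank_one less_eq_complex_def del: of_real_power)

text \<open>Polarization: the form takes real values on the diagonal, and its values at
  \<open>u + v\<close> and \<open>u + \<i> v\<close> give the imaginary and the real part of the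
  identity.\<close>

lemma psd_kernel_sesq_commute:
  assumes "psd_kernel S C"
  shows "sesq S C v u = cnj (sesq S C u v)"
proof -
  have re: "Im (sesq S C w w) = 0" for w
    using psd_kernelD[OF assms, of w] by (simp add: less_eq_complex_def)
  have "Im (sesq S C u v + sesq S C v u) = 0"
    using re[of "\<lambda>p. u p + v p"] re[of u] re[of v]
    by (simp add: sesq_add_left sesq_add_right)
  moreover have "Re (sesq S C u v) - Re (sesq S C v u) = 0"
    using re[of "\<lambda>p. u p + \<i> * v p"] re[of u] re[of v]
    by (simp add: sesq_add_left sesq_add_right sesq_scale_left[of _ _ \<i>] sesq_scale_right[of _ _ _ \<i>])
  ultimately show ?thesis by (simp add: complex_eq_iff)
qed

lemma psd_kernel_commute:
  assumes "psd_kernel S C" "finite S" "p \<in> S" "q \<in> S"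
  shows "C q p = cnj (C p q)"
  using psd_kernel_sesq_commute[OF assms(1), of "\<lambda>x. of_bool (x = p)" "\<lambda>x. of_bool (x = q)"]
  by (simp add: sesq_units assms)

lemma psd_kernel_diag:
  assumes "psd_kernel S C" "finite S" "p \<in> S"
  shows "0 \<le> C p p"
  using psd_kernelD[OF assms(1), of "\<lambda>x. of_bool (x = p)"] by (simp add: sesq_units assms)

section \<open>Cauchy-Schwarz and rank-one decompositions\<close>

lemma quadratic_nonneg_discriminant:
  fixes s b r :: real
  assumes pos: "\<And>t. 0 \<le> t\<^sup>2 * b * s + 2 * t * b + r" and "0 \<le> s" "0 \<le> b"
  shows "b \<le> s * r"
proof (cases "s = 0")
  case True
  have "b = 0"
  proof (rule ccontr)
    assume "b \<noteq> 0"
    \<comment> \<open>For \<open>s = 0\<close> the quadratic is linear in \<open>t\<close>, and this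
      \<open>t\<close> gives it the value -1.\<close>
    then show False using pos[of "- (r + 1) / (2 * b)"] True by (simp add: field_simps)
  qed
  then show ?thesis using True by simp
next
  case False
  then have "0 < s" using assms by simp
  \<comment> \<open>At \<open>- 1 / s\<close> the quadratic has the value
    \<open>r - b / s\<close>.\<close>
  then show ?thesis using pos[of "- 1 / s"] by (simp add: field_simps power2_eq_square)
qed

text \<open>With \<open>B = sesq S C u v\<close>, the form is evaluated at
  \<open>t * cnj B * u + v\<close> for real \<open>t\<close>: the factor \<open>cnj B\<close> makes
  both cross terms equal to \<open>t |B|^2\<close>, which leaves a real quadratic in
  \<open>t\<close>.\<close>

lemma psd_kernel_Cauchy_Schwarz:
  assumes C: "psd_kernel S C"
  shows "(cmod (sesq S C u v))\<^sup>2 \<le> Re (sesq S C u u) * Re (sesq S C v v)"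
proof (rule quadratic_nonneg_discriminant)
  fix t :: real
  define B where "B = sesq S C u v"
  have B': "sesq S C v u = cnj B" unfolding B_def by (rule psd_kernel_sesq_commute[OF C])
  have "0 \<le> Re (sesq S C (\<lambda>p. (t * cnj B) * u p + v p) (\<lambda>p. (t * cnj B) * u p + v p))"
    using psd_kernelD[OF C] by (simp add: less_eq_complex_def)
  also have "sesq S C (\<lambda>p. (t * cnj B) * u p + v p) (\<lambda>p. (t * cnj B) * u p + v p) =
      (t * t) * (B * cnj B) * sesq S C u u + 2 * t * (B * cnj B) + sesq S C v v"
    unfolding sesq_add_left sesq_add_right sesq_scale_left sesq_scale_right B' B_def[symmetric]
    by (simp add: algebra_simps)
  also have "\<dots> = complex_of_real (t\<^sup>2 * (cmod B)\<^sup>2) * sesq S C u u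
      + complex_of_real (2 * t * (cmod B)\<^sup>2) + sesq S C v v"
    by (simp add: complex_norm_square[symmetric] power2_eq_square)
  finally show "0 \<le> t\<^sup>2 * (cmod (sesq S C u v))\<^sup>2 * Re (sesq S C u u) + 2 * t * (cmod (sesq S C u v))\<^sup>2
      + Re (sesq S C v v)"
    by (simp add: B_def)
qed (use psd_kernelD[OF C, of u] in \<open>auto simp: less_eq_complex_def\<close>)

lemma psd_kernel_entry_bound:
  assumes C: "psd_kernel S C" "finite S" "p \<in> S" "q \<in> S"
  shows "(cmod (C p q))\<^sup>2 \<le> Re (C q q) * Re (C p p)"
  using psd_kernel_Cauchy_Schwarz[OF C(1), of "\<lambda>x. of_bool (x = q)" "\<lambda>x. of_bool (x = p)"]
  by (simp add: sesq_units C)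

text \<open>Cauchy-Schwarz as an inequality between kernels. It gives the elimination step below and
  later puts the columns of kernels into \<open>W\<close>.\<close>

lemma psd_kernel_diff_column:
  assumes C: "psd_kernel S C"
  shows "psd_kernel S (\<lambda>p q. sesq S C u u * C p q -
           (\<Sum>r\<in>S. C p r * u r) * cnj (\<Sum>r\<in>S. C q r * u r))"
  unfolding psd_kernel_def sesq_diff_kernel sesq_scale_kernel
proof
  fix v
  have "sesq S C u u * sesq S C v v = complex_of_real (Re (sesq S C u u) * Re (sesq S C v v))"
    using psd_kernelD[OF C, of u] psd_kernelD[OF C, of v]
    by (simp add: complex_eq_iff less_eq_complex_def)
  moreover have "(\<Sum>p\<in>S. (\<Sum>r\<in>S. C p r * u r) * cnj (v p)) = sesq S C u v"
    by (simp add: sesq_def sum_distrib_right)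
  ultimately show "0 \<le> sesq S C u u * sesq S C v v -
      sesq S (\<lambda>p q. (\<Sum>r\<in>S. C p r * u r) * cnj (\<Sum>r\<in>S. C q r * u r)) v v"
    using psd_kernel_Cauchy_Schwarz[OF C, of u v]
    unfolding sesq_rank_one by (simp add: less_eq_complex_def)
qed

text \<open>Cholesky elimination, by induction on the set \<open>T\<close> of rows that may still be
  nonzero: each step clears one row, splitting off a rank-one kernel when its pivot is
  nonzero.\<close>

lemma psd_kernel_sum_rank_one_aux:
  assumes "finite S" "finite T"
  shows "T \<subseteq> S \<Longrightarrow> psd_kernel S C \<Longrightarrow> (\<And>p q. p \<in> S - T \<Longrightarrow> q \<in> S \<Longrightarrow> C p q = 0) \<Longrightarrow>
    \<exists>(m::nat) w. \<forall>p\<in>S. \<forall>q\<in>S. C p q = (\<Sum>l<m. w l p * cnj (w l q))"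
  using assms(2)
proof (induction T arbitrary: C rule: finite_induct)
  case empty
  then show ?case by (intro exI[of _ 0]) auto
next
  case (insert t T)
  have tS: "t \<in> S" using insert.prems by auto
  note herm = psd_kernel_commute[OF insert.prems(2) assms(1)]
  define c where "c = Re (C t t)"
  have c: "C t t = complex_of_real c" "0 \<le> c"
    using psd_kernel_diag[OF insert.prems(2) assms(1) tS]
    by (auto simp: c_def complex_eq_iff less_eq_complex_def)
  show ?case
  proof (cases "c = 0")
    case True
    \<comment> \<open>A vanishing diagonal entry forces its whole row to vanish, by the entry
      bound.\<close>
    have "C p q = 0" if "p \<in> S - T" "q \<in> S" for p q
      using psd_kernel_entry_bound[OF insert.prems(2) assms(1), of t q] True that tS
        insert.prems(3)[of p q] c_def by (cases "p = t") auto
    then show ?thesis using insert.IH[of C] insert.prems by auto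
  next
    case False
    \<comment> \<open>Schur complement of the pivot \<open>c\<close>: semidefinite by
      \<open>psd_kernel_diff_column\<close> at the basis vector of \<open>t\<close>, and with row
      \<open>t\<close> cleared.\<close>
    define D where "D p q = C p q - C p t * cnj (C q t) / c" for p q
    have unit: "(\<Sum>r\<in>S. C p r * of_bool (r = t)) = C p t" for p
      using tS assms(1) by (simp add: of_bool_def if_distrib cong: if_cong)
    have "psd_kernel S (\<lambda>p q. c * C p q - C p t * cnj (C q t))"
      using psd_kernel_diff_column[OF insert.prems(2), of "\<lambda>x. of_bool (x = t)"]
      by (simp add: unit sesq_units tS assms(1) c(1))
    from psd_kernel_scale[OF this, of "1 / c"] have "psd_kernel S D"
      unfolding D_def using False c(2) by (simp add: field_simps)
    moreover have "D p q = 0" if "p \<in> S - T" "q \<in> S" for p q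
    proof (cases "p = t")
      case True
      then show ?thesis using False that tS herm[of q t] by (simp add: D_def c(1))
    next
      case False
      then show ?thesis using that tS insert.prems(3)[of p] by (simp add: D_def)
    qed
    ultimately obtain m :: nat and w
      where w: "\<forall>p\<in>S. \<forall>q\<in>S. D p q = (\<Sum>l<m. w l p * cnj (w l q))"
      using insert.IH[of D] insert.prems(1) by auto
    define w' where "w' = w(m := \<lambda>p. C p t / sqrt c)"
    have "C p q = (\<Sum>l<Suc m. w' l p * cnj (w' l q))" if "p \<in> S" "q \<in> S" for p q
    proof -
      have "complex_of_real (sqrt c) * complex_of_real (sqrt c) = complex_of_real c"
        using c(2) by (metis of_real_mult real_sqrt_mult_self abs_of_nonneg)
      then have "C p q = D p q + w' m p * cnj (w' m q)"
        by (simp add: D_def w'_def)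
      also have "D p q = (\<Sum>l<m. w' l p * cnj (w' l q))"
        using w that by (simp add: w'_def)
      finally show ?thesis by simp
    qed
    then show ?thesis by blast
  qed
qed

lemma psd_kernel_sum_rank_one:
  assumes "finite S" "psd_kernel S C"
  obtains m :: nat and w where "\<And>p q. p \<in> S \<Longrightarrow> q \<in> S \<Longrightarrow> C p q = (\<Sum>l<m. w l p * cnj (w l q))"
  using psd_kernel_sum_rank_one_aux[OF assms(1,1) order_refl assms(2)] that by auto

lemma sum_swap_pairs:
  "(\<Sum>a\<in>A. \<Sum>b\<in>B. \<Sum>i\<in>I. \<Sum>j\<in>J. F a b i j) =
   (\<Sum>i\<in>I. \<Sum>j\<in>J. \<Sum>a\<in>A. \<Sum>b\<in>B. F a b i j)"
  using sum.swap[of "\<lambda>(a, b) (i, j). F a b i j" "I \<times> J" "A \<times> B"]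
  by (simp add: sum.cartesian_product')

text \<open>Schur product argument: \<open>C\<close> is a sum of kernels
  \<open>w l p * cnj (w l q)\<close>, and for each \<open>l\<close> the form at \<open>v\<close>
  becomes the form of \<open>A\<close> at the contraction \<open>u l\<close> of \<open>v\<close>
  with the conjugate of \<open>w l\<close>. This is why a semidefinite Choi kernel gives a
  completely positive map.\<close>

lemma psd_kernel_contraction:
  fixes A :: "'k \<times> 'i \<Rightarrow> 'k \<times> 'i \<Rightarrow> complex" and C :: "'i \<times> 'n \<Rightarrow> 'i \<times> 'n \<Rightarrow> complex"
  assumes fin: "finite K" "finite I" "finite N"
    and A: "psd_kernel (K \<times> I) A" and C: "psd_kernel (I \<times> N) C"
  shows "psd_kernel (K \<times> N) (\<lambda>(r, a) (s, b). \<Sum>i\<in>I. \<Sum>j\<in>I. A (r, i) (s, j) * C (i, a) (j, b))"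
  unfolding psd_kernel_def
proof
  fix v :: "'k \<times> 'n \<Rightarrow> complex"
  obtain m :: nat and w where w: "\<And>p q. p \<in> I \<times> N \<Longrightarrow> q \<in> I \<times> N \<Longrightarrow>
      C p q = (\<Sum>l<m. w l p * cnj (w l q))"
    by (rule psd_kernel_sum_rank_one[OF _ C]) (use fin in auto)
  define u where "u l = (\<lambda>(s, j). \<Sum>b\<in>N. cnj (w l (j, b)) * v (s, b))" for l
  let ?F = "\<lambda>r a s b i j l. A (r, i) (s, j) * (w l (i, a) * cnj (w l (j, b))) * v (s, b) * cnj (v (r, a))"
  have inner: "(\<Sum>a\<in>N. \<Sum>b\<in>N. \<Sum>i\<in>I. \<Sum>j\<in>I. \<Sum>l<m. ?F r a s b i j l) =
      (\<Sum>l<m. \<Sum>i\<in>I. \<Sum>j\<in>I. A (r, i) (s, j) * u l (s, j) * cnj (u l (r, i)))" for r s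
  proof -
    have "(\<Sum>a\<in>N. \<Sum>b\<in>N. \<Sum>i\<in>I. \<Sum>j\<in>I. \<Sum>l<m. ?F r a s b i j l) =
        (\<Sum>i\<in>I. \<Sum>j\<in>I. \<Sum>a\<in>N. \<Sum>b\<in>N. \<Sum>l<m. ?F r a s b i j l)"
      by (rule sum_swap_pairs)
    also have "\<dots> = (\<Sum>i\<in>I. \<Sum>j\<in>I. \<Sum>a\<in>N. \<Sum>l<m. \<Sum>b\<in>N. ?F r a s b i j l)"
      by (intro sum.cong refl sum.swap)
    also have "\<dots> = (\<Sum>i\<in>I. \<Sum>j\<in>I. \<Sum>l<m. \<Sum>a\<in>N. \<Sum>b\<in>N. ?F r a s b i j l)"
      by (intro sum.cong refl sum.swap)
    also have "\<dots> = (\<Sum>i\<in>I. \<Sum>j\<in>I. \<Sum>l<m. A (r, i) (s, j) * u l (s, j) * cnj (u l (r, i)))"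
    proof (intro sum.cong refl)
      fix i j l
      have "A (r, i) (s, j) * u l (s, j) * cnj (u l (r, i)) =
          A (r, i) (s, j) * (cnj (u l (r, i)) * u l (s, j))" by simp
      also have "\<dots> = (\<Sum>a\<in>N. \<Sum>b\<in>N. ?F r a s b i j l)"
        unfolding u_def split cnj_sum sum_product
        by (simp add: sum_distrib_left mult_ac)
      finally show "(\<Sum>a\<in>N. \<Sum>b\<in>N. ?F r a s b i j l) =
          A (r, i) (s, j) * u l (s, j) * cnj (u l (r, i))" by simp
    qed
    also have "\<dots> = (\<Sum>i\<in>I. \<Sum>l<m. \<Sum>j\<in>I. A (r, i) (s, j) * u l (s, j) * cnj (u l (r, i)))"
      by (intro sum.cong refl sum.swap)
    also have "\<dots> = (\<Sum>l<m. \<Sum>i\<in>I. \<Sum>j\<in>I. A (r, i) (s, j) * u l (s, j) * cnj (u l (r, i)))"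
      by (rule sum.swap)
    finally show ?thesis .
  qed
  have "sesq (K \<times> N) (\<lambda>(r, a) (s, b). \<Sum>i\<in>I. \<Sum>j\<in>I. A (r, i) (s, j) * C (i, a) (j, b)) v v =
     (\<Sum>r\<in>K. \<Sum>a\<in>N. \<Sum>s\<in>K. \<Sum>b\<in>N. \<Sum>i\<in>I. \<Sum>j\<in>I. \<Sum>l<m. ?F r a s b i j l)"
    unfolding sesq_def sum.cartesian_product' split
    by (intro sum.cong refl)
      (auto simp: w sum_distrib_left sum_distrib_right mult_ac intro!: sum.cong)
  also have "\<dots> = (\<Sum>r\<in>K. \<Sum>s\<in>K. \<Sum>a\<in>N. \<Sum>b\<in>N. \<Sum>i\<in>I. \<Sum>j\<in>I. \<Sum>l<m. ?F r a s b i j l)"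
    by (intro sum.cong refl sum.swap)
  also have "\<dots> = (\<Sum>l<m. \<Sum>r\<in>K. \<Sum>s\<in>K. \<Sum>i\<in>I. \<Sum>j\<in>I. A (r, i) (s, j) * u l (s, j) * cnj (u l (r, i)))"
    unfolding inner by (simp only: sum.swap[of _ "{..<m}" K])
  also have "\<dots> = (\<Sum>l<m. \<Sum>r\<in>K. \<Sum>i\<in>I. \<Sum>s\<in>K. \<Sum>j\<in>I. A (r, i) (s, j) * u l (s, j) * cnj (u l (r, i)))"
    by (intro sum.cong refl sum.swap)
  also have "\<dots> = (\<Sum>l<m. sesq (K \<times> I) A (u l) (u l))"
    unfolding sesq_def sum.cartesian_product' split by simp
  finally show "0 \<le> sesq (K \<times> N) (\<lambda>(r, a) (s, b). \<Sum>i\<in>I. \<Sum>j\<in>I. A (r, i) (s, j) * C (i, a) (j, b)) v v"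
    using psd_kernelD[OF A] by (simp add: sum_nonneg)
qed

section \<open>Choi kernels and Toeplitz matrices\<close>

lemma sesq_reindex:
  assumes "bij_betw h S T"
  shows "sesq T C u v = sesq S (\<lambda>p q. C (h p) (h q)) (u \<circ> h) (v \<circ> h)"
  unfolding sesq_def by (simp add: sum.reindex_bij_betw[OF assms, symmetric])

lemma psd_kernel_reindex:
  assumes h: "bij_betw h S T"
  shows "psd_kernel T C \<longleftrightarrow> psd_kernel S (\<lambda>p q. C (h p) (h q))"
proof
  assume "psd_kernel S (\<lambda>p q. C (h p) (h q))"
  then show "psd_kernel T C" by (simp add: psd_kernel_def sesq_reindex[OF h])
next
  assume T: "psd_kernel T C"
  show "psd_kernel S (\<lambda>p q. C (h p) (h q))"
    unfolding psd_kernel_def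
  proof
    fix v
    have "sesq S (\<lambda>p q. C (h p) (h q)) v v = sesq T C (v \<circ> inv_into S h) (v \<circ> inv_into S h)"
      unfolding sesq_reindex[OF h]
      by (rule sesq_cong) (use h in \<open>auto simp: bij_betw_def\<close>)
    then show "0 \<le> sesq S (\<lambda>p q. C (h p) (h q)) v v" using psd_kernelD[OF T] by simp
  qed
qed

lemma pos_semidef_iff_psd_kernel:
  assumes "A \<in> carrier_mat m m"
  shows "pos_semidef m A \<longleftrightarrow> psd_kernel {..<m} (\<lambda>p q. A $$ (p, q))"
proof -
  have form: "(A *\<^sub>v v) \<bullet>c v = sesq {..<m} (\<lambda>p q. A $$ (p, q)) (vec_index v) (vec_index v)"
    if "v \<in> carrier_vec m" for v
    using assms that
    by (auto simp: scalar_prod_def sesq_def sum_distrib_right lessThan_atLeast0 intro!: sum.cong)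
  show ?thesis
  proof
    assume A: "pos_semidef m A"
    show "psd_kernel {..<m} (\<lambda>p q. A $$ (p, q))"
      unfolding psd_kernel_def
    proof
      fix v
      have "sesq {..<m} (\<lambda>p q. A $$ (p, q)) v v =
          sesq {..<m} (\<lambda>p q. A $$ (p, q)) (vec_index (vec m v)) (vec_index (vec m v))"
        by (rule sesq_cong) auto
      then show "0 \<le> sesq {..<m} (\<lambda>p q. A $$ (p, q)) v v"
        using A form[of "vec m v"] unfolding pos_semidef_def by (metis vec_carrier)
    qed
  next
    assume "psd_kernel {..<m} (\<lambda>p q. A $$ (p, q))"
    then show "pos_semidef m A" using assms by (auto simp: pos_semidef_def form psd_kernel_def)
  qed
qed

lemma bij_betw_block_index:
  "bij_betw (\<lambda>(i, a). i * d + a) ({..<k} \<times> {..<d}) {..<k * d :: nat}"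
proof (rule bij_betw_byWitness[where f' = "\<lambda>p. (p div d, p mod d)"])
  show "(\<lambda>(i, a). i * d + a) ` ({..<k} \<times> {..<d}) \<subseteq> {..<k * d}"
  proof clarsimp
    fix i a assume "i < k" "a < d"
    then have "i * d + a < Suc i * d" by simp
    also have "\<dots> \<le> k * d" using \<open>i < k\<close> by (intro mult_le_mono1) simp
    finally show "i * d + a < k * d" .
  qed
  show "(\<lambda>p. (p div d, p mod d)) ` {..<k * d} \<subseteq> {..<k} \<times> {..<d}"
    by (cases "d = 0") (auto simp: less_mult_imp_div_less)
qed auto

text \<open>The bijection from \<open>(i, a)\<close> to \<open>i * d + a\<close> removes the
  arithmetic of \<open>block_mat\<close>; from here on complete positivity is treated through
  kernels on pairs.\<close>

lemma pos_semidef_block_mat: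
  "pos_semidef (k * d) (block_mat k d X) \<longleftrightarrow>
     psd_kernel ({..<k} \<times> {..<d}) (\<lambda>(i, a) (j, b). X i j $$ (a, b))"
proof -
  let ?h = "\<lambda>(i, a). i * d + a"
  have bound: "?h p < k * d" if "p \<in> {..<k} \<times> {..<d}" for p
    using bij_betw_apply[OF bij_betw_block_index that] by simp
  have "pos_semidef (k * d) (block_mat k d X) \<longleftrightarrow>
      psd_kernel {..<k * d} (\<lambda>p q. block_mat k d X $$ (p, q))"
    by (rule pos_semidef_iff_psd_kernel) (simp add: block_mat_def)
  also have "\<dots> \<longleftrightarrow> psd_kernel ({..<k} \<times> {..<d}) (\<lambda>p q. block_mat k d X $$ (?h p, ?h q))"
    by (rule psd_kernel_reindex[OF bij_betw_block_index])
  also have "\<dots> \<longleftrightarrow> psd_kernel ({..<k} \<times> {..<d}) (\<lambda>(i, a) (j, b). X i j $$ (a, b))"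
    by (rule psd_kernel_cong) (use bound in \<open>auto simp: block_mat_def\<close>)
  finally show ?thesis .
qed

section \<open>Linear maps on matrix subspaces and on Toeplitz matrices\<close>

definition mat_subspace :: "nat \<Rightarrow> complex mat set \<Rightarrow> bool" where
  "mat_subspace d T \<longleftrightarrow> T \<subseteq> carrier_mat d d \<and> 0\<^sub>m d d \<in> T \<and>
     (\<forall>X\<in>T. \<forall>Y\<in>T. X + Y \<in> T) \<and> (\<forall>c. \<forall>X\<in>T. c \<cdot>\<^sub>m X \<in> T)"

lemma mat_subspace_carrier: "mat_subspace d (carrier_mat d d)"
  by (auto simp: mat_subspace_def)

lemma toeplitzI: "mat d d (\<lambda>(i, j). a (int i - int j)) \<in> toeplitz d"
  unfolding toeplitz_def by blast

lemma mat_subspace_toeplitz: "mat_subspace d (toeplitz d)"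
proof -
  have "0\<^sub>m d d \<in> toeplitz d"
    using toeplitzI[of d "\<lambda>_. 0"] by (simp add: zero_mat_def split_def)
  moreover have "X + Y \<in> toeplitz d" if X: "X \<in> toeplitz d" and Y: "Y \<in> toeplitz d" for X Y
  proof -
    obtain a b where "X = mat d d (\<lambda>(i, j). a (int i - int j))"
      and "Y = mat d d (\<lambda>(i, j). b (int i - int j))"
      using X Y unfolding toeplitz_def by blast
    then have "X + Y = mat d d (\<lambda>(i, j). (\<lambda>k. a k + b k) (int i - int j))"
      by (intro eq_matI) auto
    then show ?thesis using toeplitzI[of d "\<lambda>k. a k + b k"] by simp
  qed
  moreover have "c \<cdot>\<^sub>m X \<in> toeplitz d" if X: "X \<in> toeplitz d" for c X
  proof -
    obtain a where "X = mat d d (\<lambda>(i, j). a (int i - int j))"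
      using X unfolding toeplitz_def by blast
    then have "c \<cdot>\<^sub>m X = mat d d (\<lambda>(i, j). (\<lambda>k. c * a k) (int i - int j))"
      by (intro eq_matI) auto
    then show ?thesis using toeplitzI[of d "\<lambda>k. c * a k"] by simp
  qed
  ultimately show ?thesis by (auto simp: mat_subspace_def toeplitz_def)
qed

text \<open>Combinations are written entrywise, so that the empty sum is the zero matrix of the
  right size. Membership and value share one induction because additivity is only available inside
  \<open>T\<close>.\<close>

lemma linear_map_on_sum:
  assumes \<phi>: "linear_map_on T n \<phi>" and T: "mat_subspace d T"
    and "finite K" and "\<And>k. k \<in> K \<Longrightarrow> B k \<in> T"
  shows "mat d d (\<lambda>p. \<Sum>k\<in>K. c k * B k $$ p) \<in> T \<and>
    \<phi> (mat d d (\<lambda>p. \<Sum>k\<in>K. c k * B k $$ p)) = mat n n (\<lambda>p. \<Sum>k\<in>K. c k * \<phi> (B k) $$ p)"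
  using assms(3,4)
proof (induction K rule: finite_induct)
  case empty
  have z: "0\<^sub>m d d \<in> T" using T by (simp add: mat_subspace_def)
  \<comment> \<open>\<open>linear_map_on\<close> has no clause about zero; homogeneity with factor 0
    supplies it.\<close>
  have "\<phi> (0 \<cdot>\<^sub>m 0\<^sub>m d d) = 0 \<cdot>\<^sub>m \<phi> (0\<^sub>m d d)"
    using \<phi> z unfolding linear_map_on_def by blast
  moreover have "\<phi> (0\<^sub>m d d) \<in> carrier_mat n n" using \<phi> z by (simp add: linear_map_on_def)
  moreover have "0 \<cdot>\<^sub>m A = 0\<^sub>m m m" if "A \<in> carrier_mat m m" for A :: "complex mat" and m
    using that by (intro eq_matI) auto
  ultimately have "\<phi> (0\<^sub>m d d) = 0\<^sub>m n n" by (metis zero_carrier_mat)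
  then show ?case using z by (simp add: zero_mat_def)
next
  case (insert k K)
  let ?Y = "mat d d (\<lambda>p. \<Sum>k\<in>K. c k * B k $$ p)"
  have Y: "?Y \<in> T" "\<phi> ?Y = mat n n (\<lambda>p. \<Sum>k\<in>K. c k * \<phi> (B k) $$ p)"
    using insert by auto
  have B: "B k \<in> T" using insert.prems by simp
  then have cB: "c k \<cdot>\<^sub>m B k \<in> T" "B k \<in> carrier_mat d d" "\<phi> (B k) \<in> carrier_mat n n"
    using T \<phi> by (auto simp: mat_subspace_def linear_map_on_def)
  have eq: "mat d d (\<lambda>p. \<Sum>k\<in>insert k K. c k * B k $$ p) = c k \<cdot>\<^sub>m B k + ?Y"
    using insert.hyps cB by (intro eq_matI) auto
  have "\<phi> (c k \<cdot>\<^sub>m B k + ?Y) = c k \<cdot>\<^sub>m \<phi> (B k) + \<phi> ?Y"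
    using \<phi> B Y(1) cB(1) by (simp add: linear_map_on_def)
  also have "\<dots> = mat n n (\<lambda>p. \<Sum>k\<in>insert k K. c k * \<phi> (B k) $$ p)"
    using insert.hyps cB unfolding Y(2) by (intro eq_matI) auto
  finally show ?case unfolding eq using T Y(1) cB(1) by (auto simp: mat_subspace_def)
qed

text \<open>A spanning family of the Toeplitz matrices. Later sums run over
  \<open>{- int d..int d}\<close>, which includes zero matrices at both ends and is invariant under
  negation.\<close>

definition shift_mat :: "nat \<Rightarrow> int \<Rightarrow> complex mat" where
  "shift_mat d k = mat d d (\<lambda>(i, j). of_bool (int i - int j = k))"

lemma shift_mat_toeplitz: "shift_mat d k \<in> toeplitz d"
  unfolding shift_mat_def by (rule toeplitzI[of d "\<lambda>l. of_bool (l = k)"])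

lemma toeplitz_mat_eq_sum:
  "mat d d (\<lambda>(i, j). a (int i - int j)) =
     mat d d (\<lambda>p. \<Sum>k\<in>{- int d..int d}. a k * shift_mat d k $$ p)"
proof (intro eq_matI)
  fix i j assume "i < dim_row (mat d d (\<lambda>p. \<Sum>k\<in>{- int d..int d}. a k * shift_mat d k $$ p))"
    "j < dim_col (mat d d (\<lambda>p. \<Sum>k\<in>{- int d..int d}. a k * shift_mat d k $$ p))"
  then have ij: "i < d" "j < d" by auto
  then have "(\<Sum>k\<in>{- int d..int d}. a k * shift_mat d k $$ (i, j)) =
      (\<Sum>k\<in>{- int d..int d}. if int i - int j = k then a k else 0)"
    by (intro sum.cong) (auto simp: shift_mat_def)
  also have "\<dots> = a (int i - int j)" using ij by simp
  finally show "mat d d (\<lambda>(i, j). a (int i - int j)) $$ (i, j) =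
      mat d d (\<lambda>p. \<Sum>k\<in>{- int d..int d}. a k * shift_mat d k $$ p) $$ (i, j)"
    using ij by simp
qed auto

lemma linear_map_on_toeplitz:
  assumes "linear_map_on (toeplitz d) n \<phi>"
  shows "\<phi> (mat d d (\<lambda>(i, j). a (int i - int j))) =
    mat n n (\<lambda>p. \<Sum>k\<in>{- int d..int d}. a k * \<phi> (shift_mat d k) $$ p)"
  unfolding toeplitz_mat_eq_sum
  using linear_map_on_sum[OF assms mat_subspace_toeplitz, of "{- int d..int d}" "shift_mat d"]
    shift_mat_toeplitz by simp

lemma linear_map_on_toeplitz_eqI:
  assumes "linear_map_on (toeplitz d) n \<phi>" "linear_map_on (toeplitz d) n \<psi>"
    and "\<And>k a b. k \<in> {- int d..int d} \<Longrightarrow> a < n \<Longrightarrow> b < n \<Longrightarrow>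
      \<phi> (shift_mat d k) $$ (a, b) = \<psi> (shift_mat d k) $$ (a, b)"
    and "X \<in> toeplitz d"
  shows "\<phi> X = \<psi> X"
proof -
  obtain a where X: "X = mat d d (\<lambda>(i, j). a (int i - int j))"
    using assms(4) unfolding toeplitz_def by blast
  show ?thesis
    unfolding X linear_map_on_toeplitz[OF assms(1)] linear_map_on_toeplitz[OF assms(2)]
    using assms(3) by (intro cong_mat) auto
qed

lemma linear_map_on_cong:
  assumes "mat_subspace d T" and "\<And>X. X \<in> T \<Longrightarrow> \<phi> X = \<psi> X"
  shows "linear_map_on T n \<phi> \<longleftrightarrow> linear_map_on T n \<psi>"
proof -
  have *: "\<forall>X\<in>T. \<phi> X = \<psi> X" "\<forall>X\<in>T. \<forall>Y\<in>T. \<phi> (X + Y) = \<psi> (X + Y)"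
    "\<forall>c. \<forall>X\<in>T. \<phi> (c \<cdot>\<^sub>m X) = \<psi> (c \<cdot>\<^sub>m X)"
    using assms unfolding mat_subspace_def by blast+
  show ?thesis unfolding linear_map_on_def using * by simp
qed

section \<open>Complete positivity and the Choi correspondence\<close>

lemma completely_positiveD:
  fixes k :: nat
  assumes "completely_positive d T n \<phi>" and "\<And>i j. i < k \<Longrightarrow> j < k \<Longrightarrow> X i j \<in> T"
    and "psd_kernel ({..<k} \<times> {..<d}) (\<lambda>(i, a) (j, b). X i j $$ (a, b))"
  shows "psd_kernel ({..<k} \<times> {..<n}) (\<lambda>(i, a) (j, b). \<phi> (X i j) $$ (a, b))"
  using assms unfolding completely_positive_def pos_semidef_block_mat by simp

lemma completely_positive_cong:
  assumes T: "mat_subspace d T" and eq: "\<And>X. X \<in> T \<Longrightarrow> \<phi> X = \<psi> X"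
    and \<phi>: "completely_positive d T n \<phi>"
  shows "completely_positive d T n \<psi>"
  unfolding completely_positive_def pos_semidef_block_mat
proof (intro conjI allI impI)
  show "linear_map_on T n \<psi>"
    using \<phi> linear_map_on_cong[of d T \<phi> \<psi> n, OF T eq] unfolding completely_positive_def by blast
next
  fix k :: nat and X
  assume X: "\<forall>i<k. \<forall>j<k. X i j \<in> T"
    and pos: "psd_kernel ({..<k} \<times> {..<d}) (\<lambda>(i, a) (j, b). X i j $$ (a, b))"
  have "psd_kernel ({..<k} \<times> {..<n}) (\<lambda>(i, a) (j, b). \<phi> (X i j) $$ (a, b))"
    by (rule completely_positiveD[OF \<phi> _ pos]) (use X in auto)
  then show "psd_kernel ({..<k} \<times> {..<n}) (\<lambda>(i, a) (j, b). \<psi> (X i j) $$ (a, b))"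
    by (rule psd_kernel_cong[THEN iffD1, rotated]) (use X eq in auto)
qed

text \<open>The map with Choi matrix \<open>C\<close>: in an index \<open>(i, a)\<close>,
  \<open>i\<close> belongs to the input and \<open>a\<close> to the output.\<close>

definition choi_map ::
    "nat \<Rightarrow> nat \<Rightarrow> (nat \<times> nat \<Rightarrow> nat \<times> nat \<Rightarrow> complex) \<Rightarrow> complex mat \<Rightarrow> complex mat" where
  "choi_map d n C X = mat n n (\<lambda>(a, b). \<Sum>i<d. \<Sum>j<d. X $$ (i, j) * C (i, a) (j, b))"

lemma choi_map_carrier [simp]: "choi_map d n C X \<in> carrier_mat n n"
  by (simp add: choi_map_def)

lemma choi_map_index:
  "a < n \<Longrightarrow> b < n \<Longrightarrow> choi_map d n C X $$ (a, b) = (\<Sum>i<d. \<Sum>j<d. X $$ (i, j) * C (i, a) (j, b))"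
  by (simp add: choi_map_def)

lemma choi_map_linear:
  assumes "T \<subseteq> carrier_mat d d"
  shows "linear_map_on T n (choi_map d n C)"
proof -
  have "choi_map d n C (X + Y) = choi_map d n C X + choi_map d n C Y"
    if "X \<in> carrier_mat d d" "Y \<in> carrier_mat d d" for X Y
    using that
    by (intro eq_matI) (auto simp: choi_map_def algebra_simps sum.distrib[symmetric] intro!: sum.cong)
  moreover have "choi_map d n C (c \<cdot>\<^sub>m X) = c \<cdot>\<^sub>m choi_map d n C X"
    if "X \<in> carrier_mat d d" for c X
    using that by (intro eq_matI) (auto simp: choi_map_def sum_distrib_left mult.assoc intro!: sum.cong)
  ultimately show ?thesis using assms unfolding linear_map_on_def by (meson choi_map_carrier subsetD)
qed

lemma choi_map_completely_positive:
  assumes C: "psd_kernel ({..<d} \<times> {..<n}) C" and T: "T \<subseteq> carrier_mat d d"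
  shows "completely_positive d T n (choi_map d n C)"
  unfolding completely_positive_def pos_semidef_block_mat
proof (intro conjI choi_map_linear[OF T] allI impI)
  fix k :: nat and X
  assume "psd_kernel ({..<k} \<times> {..<d}) (\<lambda>(i, a) (j, b). X i j $$ (a, b))"
  from psd_kernel_contraction[OF _ _ _ this C]
  have "psd_kernel ({..<k} \<times> {..<n}) (\<lambda>(r, a) (s, b). \<Sum>i<d. \<Sum>j<d. X r s $$ (i, j) * C (i, a) (j, b))"
    by simp
  then show "psd_kernel ({..<k} \<times> {..<n}) (\<lambda>(i, a) (j, b). choi_map d n C (X i j) $$ (a, b))"
    by (rule psd_kernel_cong[THEN iffD1, rotated]) (auto simp: choi_map_index)
qed

definition choi_kernel ::
    "nat \<Rightarrow> (complex mat \<Rightarrow> complex mat) \<Rightarrow> nat \<times> nat \<Rightarrow> nat \<times> nat \<Rightarrow> complex" where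
  "choi_kernel d \<Phi> = (\<lambda>(i, a) (j, b). \<Phi> (mat d d (\<lambda>p. of_bool (p = (i, j)))) $$ (a, b))"

text \<open>The matrix units, taken as blocks, form the rank-one kernel of the sum of all
  \<open>e_i \<otimes> e_i\<close>, so \<open>\<Phi>\<close> may be applied to them
  blockwise.\<close>

lemma choi_kernel_psd:
  assumes "completely_positive d (carrier_mat d d) n \<Phi>"
  shows "psd_kernel ({..<d} \<times> {..<n}) (choi_kernel d \<Phi>)"
proof -
  let ?E = "\<lambda>i j. mat d d (\<lambda>p. of_bool (p = (i, j)) :: complex)"
  let ?e = "\<lambda>(i, a). of_bool (i = a) :: complex"
  have "psd_kernel ({..<d} \<times> {..<d}) (\<lambda>p q. ?e p * cnj (?e q))"
    by (rule psd_kernel_rank_one)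
  then have "psd_kernel ({..<d} \<times> {..<d}) (\<lambda>(i, a) (j, b). ?E i j $$ (a, b))"
    by (rule psd_kernel_cong[THEN iffD1, rotated]) auto
  then show ?thesis
    unfolding choi_kernel_def by (intro completely_positiveD[OF assms]) simp
qed

lemma choi_map_choi_kernel:
  assumes \<Phi>: "linear_map_on (carrier_mat d d) n \<Phi>" and X: "X \<in> carrier_mat d d"
  shows "\<Phi> X = choi_map d n (choi_kernel d \<Phi>) X"
proof -
  let ?E = "\<lambda>r. mat d d (\<lambda>p. of_bool (p = r) :: complex)"
  have "X = mat d d (\<lambda>p. \<Sum>r\<in>{..<d} \<times> {..<d}. X $$ r * ?E r $$ p)"
  proof (intro eq_matI)
    fix i j assume "i < dim_row (mat d d (\<lambda>p. \<Sum>r\<in>{..<d} \<times> {..<d}. X $$ r * ?E r $$ p))"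
      "j < dim_col (mat d d (\<lambda>p. \<Sum>r\<in>{..<d} \<times> {..<d}. X $$ r * ?E r $$ p))"
    then have ij: "i < d" "j < d" by auto
    then have "(\<Sum>r\<in>{..<d} \<times> {..<d}. X $$ r * ?E r $$ (i, j)) =
        (\<Sum>r\<in>{..<d} \<times> {..<d}. if (i, j) = r then X $$ r else 0)"
      by (intro sum.cong) auto
    then show "X $$ (i, j) = mat d d (\<lambda>p. \<Sum>r\<in>{..<d} \<times> {..<d}. X $$ r * ?E r $$ p) $$ (i, j)"
      using ij by simp
  qed (use X in auto)
  then have "\<Phi> X = \<Phi> (mat d d (\<lambda>p. \<Sum>r\<in>{..<d} \<times> {..<d}. X $$ r * ?E r $$ p))" by simp
  also have "\<dots> = mat n n (\<lambda>p. \<Sum>r\<in>{..<d} \<times> {..<d}. X $$ r * \<Phi> (?E r) $$ p)"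
    using linear_map_on_sum[OF \<Phi> mat_subspace_carrier, of "{..<d} \<times> {..<d}" ?E] by simp
  also have "\<dots> = choi_map d n (choi_kernel d \<Phi>) X"
    unfolding choi_map_def choi_kernel_def
    by (intro cong_mat) (auto simp: sum.cartesian_product')
  finally show ?thesis .
qed

section \<open>Existence of an extension\<close>

text \<open>Tychonoff's theorem; applied once for each argument, it gives compact boxes of
  kernels.\<close>

lemma compact_functions:
  assumes "\<And>i. compact (B i)"
  shows "compact {f. \<forall>i. f i \<in> B i}"
proof -
  have "compactin (product_topology (\<lambda>i. euclidean) UNIV) (PiE UNIV B)"
    using assms by (simp add: compactin_PiE)
  then show ?thesis by (simp add: euclidean_product_topology PiE_UNIV_domain Pi_def)
qed

lemma compact_complex_disc: "compact {z :: complex. cmod z \<le> r}"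
proof -
  let ?g = "\<lambda>p :: real \<times> real. complex_of_real (fst p) + \<i> * complex_of_real (snd p)"
  have box: "compact (?g ` ({- r..r} \<times> {- r..r}))"
    by (intro compact_continuous_image compact_Times compact_Icc continuous_intros)
  have closed: "closed {z :: complex. cmod z \<le> r}"
    by (intro closed_Collect_le continuous_intros)
  have "{z. cmod z \<le> r} \<subseteq> ?g ` ({- r..r} \<times> {- r..r})"
  proof
    fix z assume "z \<in> {z. cmod z \<le> r}"
    then have "\<bar>Re z\<bar> \<le> r" "\<bar>Im z\<bar> \<le> r"
      using abs_Re_le_cmod[of z] abs_Im_le_cmod[of z] by auto
    then show "z \<in> ?g ` ({- r..r} \<times> {- r..r})"
      by (intro image_eqI[of _ _ "(Re z, Im z)"]) (auto simp: complex_eq_iff)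
  qed
  then have "?g ` ({- r..r} \<times> {- r..r}) \<inter> {z. cmod z \<le> r} = {z. cmod z \<le> r}"
    by (rule Int_absorb1)
  then show ?thesis using compact_Int_closed[OF box closed] by simp
qed

lemma continuous_on_kernel_entry:
  "continuous_on UNIV (\<lambda>C :: 'a \<Rightarrow> 'b \<Rightarrow> 'c::topological_space. C p q)"
  by (rule continuous_on_product_then_coordinatewise[OF continuous_on_product_coordinates])

lemma closed_psd_kernel: "closed {C. psd_kernel S C}"
proof -
  have "continuous_on UNIV (\<lambda>C. sesq S C v v)" for v
    unfolding sesq_def by (intro continuous_intros continuous_on_kernel_entry)
  then have "closed {C. \<forall>v. 0 \<le> Re (sesq S C v v) \<and> 0 = Im (sesq S C v v)}"
    by (intro closed_Collect_all closed_Collect_conj closed_Collect_le closed_Collect_eq continuous_intros)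
  then show ?thesis by (simp add: psd_kernel_def less_eq_complex_def)
qed

text \<open>First-order condition at a minimum. The bound \<open>t < 1\<close> is there because the
  segment from a kernel towards zero is followed only that far.\<close>

lemma linear_coeff_nonneg:
  fixes P Q :: real
  assumes pos: "\<And>t. 0 < t \<Longrightarrow> t < 1 \<Longrightarrow> 0 \<le> 2 * t * P + t\<^sup>2 * Q" and "0 \<le> Q"
  shows "0 \<le> P"
proof (rule ccontr)
  assume "\<not> 0 \<le> P"
  then have P: "P < 0" by simp
  \<comment> \<open>This \<open>t\<close> lies in \<open>(0, 1)\<close> and has
    \<open>t * Q \<le> - P\<close>, so the linear term wins:
    \<open>2 * P + t * Q \<le> P < 0\<close>.\<close>
  define t where "t = - P / (Q + 1 - P)"
  have t: "0 < t" "t < 1" using P \<open>0 \<le> Q\<close> by (auto simp: t_def field_simps)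
  have "t * Q \<le> - P"
  proof -
    have "t * Q \<le> t * (Q + 1 - P)" using t P by (intro mult_left_mono) auto
    also have "\<dots> = - P" using P \<open>0 \<le> Q\<close> by (simp add: t_def)
    finally show ?thesis .
  qed
  then have "t * (2 * P + t * Q) < 0" using t P by (intro mult_pos_neg) auto
  moreover have "t * (2 * P + t * Q) = 2 * t * P + t\<^sup>2 * Q"
    by (simp add: power2_eq_square algebra_simps)
  ultimately show False using pos[OF t] by simp
qed

lemma cmod_add_scaled_square:
  "(cmod (a + complex_of_real t * b))\<^sup>2 = (cmod a)\<^sup>2 + 2 * t * Re (cnj a * b) + t\<^sup>2 * (cmod b)\<^sup>2"
  by (simp add: cmod_power2) (simp add: power2_eq_square algebra_simps)

lemma psd_kernel_zero: "psd_kernel S (\<lambda>_ _. 0)"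
  by (simp add: psd_kernel_def sesq_def)

text \<open>The residual of a least squares solution over the positive semidefinite cone is
  nonnegative on the cone and annihilates the solution.\<close>

lemma psd_kernel_solution_exists:
  fixes L :: "('a \<Rightarrow> 'a \<Rightarrow> complex) \<Rightarrow> 'j \<Rightarrow> complex"
  assumes S: "finite S" and J: "finite J"
    and L_add: "\<And>C D j. j \<in> J \<Longrightarrow> L (\<lambda>p q. C p q + D p q) j = L C j + L D j"
    and L_scale: "\<And>r C j. j \<in> J \<Longrightarrow> L (\<lambda>p q. complex_of_real r * C p q) j = r * L C j"
    and L_cong: "\<And>C D j. j \<in> J \<Longrightarrow> (\<And>p q. p \<in> S \<Longrightarrow> q \<in> S \<Longrightarrow> C p q = D p q) \<Longrightarrow> L C j = L D j"
    and L_cont: "\<And>j. j \<in> J \<Longrightarrow> continuous_on UNIV (\<lambda>C. L C j)"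
    and L_diag: "\<And>C p. psd_kernel S C \<Longrightarrow> p \<in> S \<Longrightarrow> cmod (C p p) \<le> (\<Sum>j\<in>J. cmod (L C j))"
    and dual: "\<And>R. (\<And>D. psd_kernel S D \<Longrightarrow> 0 \<le> (\<Sum>j\<in>J. Re (cnj (R j) * L D j))) \<Longrightarrow>
      0 \<le> (\<Sum>j\<in>J. Re (cnj (R j) * f j))"
  shows "\<exists>C. psd_kernel S C \<and> (\<forall>j\<in>J. L C j = f j)"
proof -
  define G where "G C = (\<Sum>j\<in>J. (cmod (L C j - f j))\<^sup>2)" for C
  \<comment> \<open>A kernel with an entry beyond \<open>B\<close> has such large data
    \<open>L D\<close> that it fits \<open>f\<close> no better than the zero kernel; so a bounded
    part of the cone suffices.\<close>
  define B where "B = (\<Sum>j\<in>J. cmod (f j) + sqrt (G (\<lambda>_ _. 0)))"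
  have G_nonneg: "0 \<le> G C" for C by (simp add: G_def sum_nonneg)
  have B_nonneg: "0 \<le> B" using G_nonneg by (simp add: B_def sum_nonneg)
  \<comment> \<open>Forcing the entries off \<open>S\<close> to be zero makes the box compact in the
    space of all functions; by \<open>L_cong\<close> nothing is lost.\<close>
  define K where "K = {C. \<forall>p q. C p q \<in> (if p \<in> S \<and> q \<in> S then {z. cmod z \<le> B} else {0})}"
  have "compact {g. \<forall>q. g q \<in> (if p \<in> S \<and> q \<in> S then {z. cmod z \<le> B} else {0 :: complex})}" for p
    by (rule compact_functions) (auto intro: compact_complex_disc)
  then have "compact {C. \<forall>p. C p \<in> {g. \<forall>q. g q \<in> (if p \<in> S \<and> q \<in> S then {z. cmod z \<le> B} else {0 :: complex})}}"
    by (rule compact_functions)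
  then have "compact K" by (simp add: K_def)
  then have comp: "compact (K \<inter> {C. psd_kernel S C})"
    by (intro compact_Int_closed closed_psd_kernel)
  have zero: "(\<lambda>_ _. 0) \<in> K \<inter> {C. psd_kernel S C}"
    using B_nonneg by (simp add: K_def psd_kernel_zero)
  have "continuous_on UNIV G"
    unfolding G_def by (intro continuous_intros L_cont)
  then have "continuous_on (K \<inter> {C. psd_kernel S C}) G" by (rule continuous_on_subset) simp
  with comp zero obtain C where C: "C \<in> K \<inter> {C. psd_kernel S C}"
    and min: "\<And>D. D \<in> K \<inter> {C. psd_kernel S C} \<Longrightarrow> G C \<le> G D"
    using continuous_attains_inf[of "K \<inter> {C. psd_kernel S C}" G] by blast
  have C_psd: "psd_kernel S C" using C by simp
  have G_min: "G C \<le> G D" if D: "psd_kernel S D" for D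
  proof (cases "\<forall>p\<in>S. \<forall>q\<in>S. cmod (D p q) \<le> B")
    case True
    define D' where "D' p q = (if p \<in> S \<and> q \<in> S then D p q else 0)" for p q
    have "psd_kernel S D'" using D by (rule psd_kernel_cong[THEN iffD1, rotated]) (simp add: D'_def)
    then have "D' \<in> K \<inter> {C. psd_kernel S C}" using True by (simp add: K_def D'_def)
    moreover have "L D' j = L D j" if "j \<in> J" for j
      by (rule L_cong[OF that]) (simp add: D'_def)
    then have "G D' = G D" by (simp add: G_def)
    ultimately show ?thesis using min by metis
  next
    case False
    then obtain p q where pq: "p \<in> S" "q \<in> S" "B < cmod (D p q)" by auto
    \<comment> \<open>A large entry of \<open>D\<close> forces a large diagonal entry and hence, by
      \<open>L_diag\<close>, a large \<open>L D\<close>; then a single coordinate costs at least as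
      much as the zero kernel does in total.\<close>
    have diag: "Re (D r r) \<le> (\<Sum>j\<in>J. cmod (L D j))" "0 \<le> Re (D r r)" if "r \<in> S" for r
      using L_diag[OF D that] complex_Re_le_cmod[of "D r r"] psd_kernel_diag[OF D S that]
      by (auto simp: less_eq_complex_def)
    have "(cmod (D p q))\<^sup>2 \<le> Re (D q q) * Re (D p p)"
      by (rule psd_kernel_entry_bound[OF D S pq(1,2)])
    also have "\<dots> \<le> (\<Sum>j\<in>J. cmod (L D j))\<^sup>2"
      unfolding power2_eq_square using diag pq by (intro mult_mono) (auto simp: sum_nonneg)
    finally have "cmod (D p q) \<le> (\<Sum>j\<in>J. cmod (L D j))"
      by (rule power2_le_imp_le) (simp add: sum_nonneg)
    then have "B < (\<Sum>j\<in>J. cmod (L D j))" using pq(3) by simp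
    then have "\<not> (\<forall>j\<in>J. cmod (L D j) \<le> cmod (f j) + sqrt (G (\<lambda>_ _. 0)))"
      unfolding B_def using sum_mono[of J "\<lambda>j. cmod (L D j)"] by fastforce
    then obtain j where j: "j \<in> J" "cmod (f j) + sqrt (G (\<lambda>_ _. 0)) < cmod (L D j)"
      by auto
    then have "sqrt (G (\<lambda>_ _. 0)) \<le> cmod (L D j - f j)"
      using norm_triangle_ineq2[of "L D j" "f j"] by simp
    then have "G (\<lambda>_ _. 0) \<le> (cmod (L D j - f j))\<^sup>2"
      by (rule sqrt_le_D)
    also have "\<dots> \<le> G D" unfolding G_def using j(1) J by (intro member_le_sum) auto
    finally show ?thesis using min[OF zero] by simp
  qed
  \<comment> \<open>\<open>R\<close> is the residual. Along a direction \<open>D\<close>,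
    \<open>G\<close> has slope \<open>2 * P D\<close> at \<open>C\<close> and quadratic coefficient
    \<open>Q D\<close>.\<close>
  define R where "R j = L C j - f j" for j
  define P where "P D = (\<Sum>j\<in>J. Re (cnj (R j) * L D j))" for D
  define Q where "Q D = (\<Sum>j\<in>J. (cmod (L D j))\<^sup>2)" for D
  have Q_nonneg: "0 \<le> Q D" for D by (simp add: Q_def sum_nonneg)
  have expand: "G (\<lambda>p q. C p q + complex_of_real t * D p q) = G C + 2 * t * P D + t\<^sup>2 * Q D" for t D
  proof -
    have "G (\<lambda>p q. C p q + complex_of_real t * D p q) = (\<Sum>j\<in>J. (cmod (R j + t * L D j))\<^sup>2)"
      unfolding G_def R_def by (intro sum.cong refl) (simp add: L_add L_scale algebra_simps)
    then show ?thesis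
      by (simp add: cmod_add_scaled_square G_def R_def P_def Q_def sum.distrib sum_distrib_left mult.assoc)
  qed
  have P_nonneg: "0 \<le> P D" if D: "psd_kernel S D" for D
  proof (rule linear_coeff_nonneg[OF _ Q_nonneg])
    fix t :: real assume "0 < t"
    then have "psd_kernel S (\<lambda>p q. C p q + complex_of_real t * D p q)"
      by (intro psd_kernel_add C_psd psd_kernel_scale D) simp
    from G_min[OF this] show "0 \<le> 2 * t * P D + t\<^sup>2 * Q D" by (simp add: expand)
  qed
  \<comment> \<open>Moving from \<open>C\<close> towards zero also stays in the cone, which bounds
    \<open>P C\<close> from above.\<close>
  have "0 \<le> - P C"
  proof (rule linear_coeff_nonneg[OF _ Q_nonneg])
    fix t :: real assume "0 < t" "t < 1"
    then have "psd_kernel S (\<lambda>p q. complex_of_real (1 - t) * C p q)"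
      by (intro psd_kernel_scale C_psd) simp
    then have "psd_kernel S (\<lambda>p q. C p q + complex_of_real (- t) * C p q)"
      by (simp add: algebra_simps)
    from G_min[OF this] show "0 \<le> 2 * t * - P C + t\<^sup>2 * Q C" by (simp only: expand) simp
  qed
  moreover have "0 \<le> (\<Sum>j\<in>J. Re (cnj (R j) * f j))"
    using dual[of R] P_nonneg by (simp add: P_def)
  \<comment> \<open>The squared norm of the residual is a difference of two pairings:
    \<open>P C\<close>, which is at most zero, and the pairing of \<open>R\<close> with
    \<open>f\<close>, which is nonnegative by \<open>dual\<close>.\<close>
  moreover have "(\<Sum>j\<in>J. (cmod (R j))\<^sup>2) = P C - (\<Sum>j\<in>J. Re (cnj (R j) * f j))"
  proof -
    have "(cmod (R j))\<^sup>2 = Re (cnj (R j) * L C j) - Re (cnj (R j) * f j)" for j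
      by (simp add: cmod_power2 R_def) (simp add: power2_eq_square algebra_simps)
    then show ?thesis by (simp add: P_def sum_subtractf)
  qed
  ultimately have "(\<Sum>j\<in>J. (cmod (R j))\<^sup>2) \<le> 0" by simp
  moreover have "(cmod (R j))\<^sup>2 \<le> (\<Sum>j\<in>J. (cmod (R j))\<^sup>2)" if "j \<in> J" for j
    using that J by (intro member_le_sum) auto
  ultimately have "(cmod (R j))\<^sup>2 \<le> 0" if "j \<in> J" for j
    using that order_trans by blast
  then have "R j = 0" if "j \<in> J" for j using that by fastforce
  then show ?thesis using C_psd by (auto simp: R_def)
qed

section \<open>Adjoint symmetry of completely positive maps on Toeplitz matrices\<close>

lemma sesq_adjoint: "sesq S (\<lambda>p q. cnj (C q p)) u v = cnj (sesq S C v u)"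
  unfolding sesq_def by (subst sum.swap) (simp add: mult_ac)

text \<open>Each product \<open>|v p| |v q|\<close> is at most the mean of the two squares, so the
  form of \<open>H\<close> at \<open>v\<close> has modulus at most \<open>r * card S\<close> times
  the squared norm of \<open>v\<close>. It serves to build positive Toeplitz matrices from
  shifts.\<close>

lemma psd_kernel_diag_dominant:
  fixes r :: real
  assumes S: "finite S" and herm: "\<And>p q. p \<in> S \<Longrightarrow> q \<in> S \<Longrightarrow> H q p = cnj (H p q)"
    and bound: "\<And>p q. p \<in> S \<Longrightarrow> q \<in> S \<Longrightarrow> cmod (H p q) \<le> r"
  shows "psd_kernel S (\<lambda>p q. complex_of_real (r * card S) * of_bool (p = q) + H p q)"
  unfolding psd_kernel_def sesq_add_kernel sesq_scale_kernel
proof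
  fix v
  have "sesq S H v v = cnj (sesq S H v v)"
    unfolding sesq_adjoint[symmetric] by (rule sesq_cong[OF _ refl refl]) (rule herm)
  then have im: "Im (sesq S H v v) = 0" by (simp add: complex_eq_iff)
  have diag: "sesq S (\<lambda>p q. of_bool (p = q)) v v = complex_of_real (\<Sum>p\<in>S. (cmod (v p))\<^sup>2)"
  proof -
    have "sesq S (\<lambda>p q. of_bool (p = q)) v v = (\<Sum>p\<in>S. \<Sum>q\<in>S. if p = q then v q * cnj (v p) else 0)"
      unfolding sesq_def by (intro sum.cong) auto
    then show ?thesis using S by (simp add: complex_norm_square del: of_real_power)
  qed
  have "cmod (sesq S H v v) \<le> (\<Sum>p\<in>S. \<Sum>q\<in>S. r * ((cmod (v p))\<^sup>2 / 2 + (cmod (v q))\<^sup>2 / 2))"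
    unfolding sesq_def
  proof (intro sum_norm_le)
    fix p q assume pq: "p \<in> S" "q \<in> S"
    have r: "0 \<le> r" using bound[OF pq] norm_ge_zero order_trans by blast
    have "cmod (H p q * v q * cnj (v p)) = cmod (H p q) * (cmod (v q) * cmod (v p))"
      by (simp add: norm_mult)
    also have "\<dots> \<le> r * ((cmod (v p))\<^sup>2 / 2 + (cmod (v q))\<^sup>2 / 2)"
      using bound[OF pq] r sum_squares_bound[of "cmod (v q)" "cmod (v p)"]
      by (intro mult_mono) auto
    finally show "cmod (H p q * v q * cnj (v p)) \<le> r * ((cmod (v p))\<^sup>2 / 2 + (cmod (v q))\<^sup>2 / 2)" .
  qed
  also have "\<dots> = r * card S * (\<Sum>p\<in>S. (cmod (v p))\<^sup>2)"
    by (simp add: sum_distrib_left[symmetric] sum.distrib sum_divide_distrib[symmetric])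
  finally have "- Re (sesq S H v v) \<le> r * card S * (\<Sum>p\<in>S. (cmod (v p))\<^sup>2)"
    using abs_Re_le_cmod[of "sesq S H v v"] by linarith
  then show "0 \<le> complex_of_real (r * card S) * sesq S (\<lambda>p q. of_bool (p = q)) v v + sesq S H v v"
    unfolding diag of_real_mult[symmetric] by (simp add: less_eq_complex_def im)
qed

lemma completely_positive_psd:
  assumes \<phi>: "completely_positive d T n \<phi>" and X: "X \<in> T"
    and pos: "psd_kernel {..<d} (\<lambda>i j. X $$ (i, j))"
  shows "psd_kernel {..<n} (\<lambda>a b. \<phi> X $$ (a, b))"
proof -
  have bij: "bij_betw (\<lambda>i. (0, i)) {..<m} ({..<1 :: nat} \<times> {..<m})" for m :: nat
    by (rule bij_betwI') auto
  have "psd_kernel ({..<1 :: nat} \<times> {..<d}) (\<lambda>(r, i) (s, j). X $$ (i, j))"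
    by (rule psd_kernel_reindex[OF bij, THEN iffD2]) (simp add: pos)
  then have "psd_kernel ({..<1 :: nat} \<times> {..<n}) (\<lambda>(r, a) (s, b). \<phi> X $$ (a, b))"
    by (intro completely_positiveD[OF \<phi>, where X = "\<lambda>_ _. X"] X)
  from psd_kernel_reindex[OF bij, THEN iffD1, OF this] show ?thesis by simp
qed

text \<open>Complete positivity speaks of positive matrices only, so the Hermitian matrix
  \<open>w E + cnj w F\<close>, with \<open>F\<close> the adjoint of the shift \<open>E\<close>, is
  made positive by adding a multiple of the identity. The choices \<open>w = 1\<close> and
  \<open>w = \<i>\<close> then separate \<open>E\<close> from \<open>F\<close>.\<close>

lemma completely_positive_shift_adjoint:
  assumes \<phi>: "completely_positive d (toeplitz d) n \<phi>" and ab: "a < n" "b < n"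
  shows "\<phi> (shift_mat d (- k)) $$ (b, a) = cnj (\<phi> (shift_mat d k) $$ (a, b))"
proof -
  have lin: "linear_map_on (toeplitz d) n \<phi>" using \<phi> by (simp add: completely_positive_def)
  note T = shift_mat_toeplitz mat_subspace_toeplitz[unfolded mat_subspace_def]
  let ?E = "shift_mat d k" and ?F = "shift_mat d (- k)" and ?I = "shift_mat d 0"
  have carr: "\<phi> (shift_mat d l) \<in> carrier_mat n n" for l
    using lin shift_mat_toeplitz unfolding linear_map_on_def by blast
  have herm: "\<phi> X $$ (b, a) = cnj (\<phi> X $$ (a, b))"
    if "X \<in> toeplitz d" "psd_kernel {..<d} (\<lambda>i j. X $$ (i, j))" for X
    by (rule psd_kernel_commute[OF completely_positive_psd[OF \<phi> that]]) (use ab in auto)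
  have "psd_kernel {..<d} (\<lambda>i j. ?I $$ (i, j))"
  proof (rule psd_kernel_cong[THEN iffD1])
    \<comment> \<open>With \<open>r = 1 / d\<close> the diagonal factor is 1; for
      \<open>d = 0\<close> there are no indices to compare.\<close>
    show "psd_kernel {..<d} (\<lambda>i j. complex_of_real (1 / d * card {..<d}) * of_bool (i = j) + 0)"
      by (rule psd_kernel_diag_dominant) auto
  qed (auto simp: shift_mat_def)
  then have I: "\<phi> ?I $$ (b, a) = cnj (\<phi> ?I $$ (a, b))" by (rule herm[OF shift_mat_toeplitz])
  have sum: "w * \<phi> ?E $$ (b, a) + cnj w * \<phi> ?F $$ (b, a) =
      cnj (w * \<phi> ?E $$ (a, b) + cnj w * \<phi> ?F $$ (a, b))" if w: "cmod w = 1" for w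
  proof -
    \<comment> \<open>The entries of \<open>w E + cnj w F\<close> have modulus at most 2, whence
      twice the dimension.\<close>
    define c where "c = complex_of_real (2 * real (card {..<d}))"
    let ?X = "c \<cdot>\<^sub>m ?I + (w \<cdot>\<^sub>m ?E + cnj w \<cdot>\<^sub>m ?F)"
    have X: "?X \<in> toeplitz d" using T by blast
    have "psd_kernel {..<d} (\<lambda>i j. c * of_bool (i = j) +
        (w * of_bool (int i - int j = k) + cnj w * of_bool (int i - int j = - k)))"
      unfolding c_def
    proof (rule psd_kernel_diag_dominant)
      fix i j
      show "cmod (w * of_bool (int i - int j = k) + cnj w * of_bool (int i - int j = - k)) \<le> 2"
        by (rule order_trans[OF norm_triangle_ineq]) (simp add: norm_mult w of_bool_def)
    qed (auto simp: of_bool_def)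
    then have "psd_kernel {..<d} (\<lambda>i j. ?X $$ (i, j))"
      by (rule psd_kernel_cong[THEN iffD1, rotated]) (auto simp: shift_mat_def)
    then have "\<phi> ?X $$ (b, a) = cnj (\<phi> ?X $$ (a, b))" by (rule herm[OF X])
    moreover have "\<phi> ?X = c \<cdot>\<^sub>m \<phi> ?I + (w \<cdot>\<^sub>m \<phi> ?E + cnj w \<cdot>\<^sub>m \<phi> ?F)"
      using lin T unfolding linear_map_on_def by metis
    ultimately show ?thesis using carr[of 0] carr[of k] carr[of "- k"] ab I
      by (simp add: c_def)
  qed
  show ?thesis using sum[of 1] sum[of \<i>] by (simp add: complex_eq_iff)
qed

lemma choi_map_shift:
  "a < n \<Longrightarrow> b < n \<Longrightarrow> choi_map d n C (shift_mat d k) $$ (a, b) =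
     (\<Sum>i<d. \<Sum>j<d. of_bool (int i - int j = k) * C (i, a) (j, b))"
  by (simp add: choi_map_index shift_mat_def)

text \<open>Arveson extension in finite dimension: least squares in the coordinates
  \<open>L\<close>, the entries of the values at the shift matrices. Complete positivity of
  \<open>\<phi>\<close> enters in verifying the duality hypothesis.\<close>

lemma completely_positive_extension_exists:
  assumes \<phi>: "completely_positive d (toeplitz d) n \<phi>"
  obtains C where "psd_kernel ({..<d} \<times> {..<n}) C" "\<And>X. X \<in> toeplitz d \<Longrightarrow> choi_map d n C X = \<phi> X"
proof -
  have lin: "linear_map_on (toeplitz d) n \<phi>" using \<phi> by (simp add: completely_positive_def)
  define S where "S = {..<d} \<times> {..<n}"
  define J where "J = {- int d..int d} \<times> {..<n} \<times> {..<n}"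
  define L where "L C = (\<lambda>(k, a, b). choi_map d n C (shift_mat d k) $$ (a, b))" for C
  define f where "f = (\<lambda>(k, a, b). \<phi> (shift_mat d k) $$ (a, b))"
  have L: "L C (k, a, b) = (\<Sum>i<d. \<Sum>j<d. of_bool (int i - int j = k) * C (i, a) (j, b))"
    if "(k, a, b) \<in> J" for C k a b
    using that by (auto simp: L_def J_def choi_map_shift)
  have fin: "finite S" "finite J" by (auto simp: S_def J_def)
  have "\<exists>C. psd_kernel S C \<and> (\<forall>j\<in>J. L C j = f j)"
  proof (rule psd_kernel_solution_exists[OF fin, of L f])
    fix C D j assume "j \<in> J"
    then show "L (\<lambda>p q. C p q + D p q) j = L C j + L D j"
      by (cases j) (simp add: L distrib_left sum.distrib)
  next
    fix r C j assume "j \<in> J"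
    then show "L (\<lambda>p q. complex_of_real r * C p q) j = r * L C j"
      by (cases j) (simp only: L sum_distrib_left mult.left_commute[of _ "complex_of_real r"])
  next
    fix C D :: "nat \<times> nat \<Rightarrow> nat \<times> nat \<Rightarrow> complex" and j
    assume j: "j \<in> J" and "\<And>p q. p \<in> S \<Longrightarrow> q \<in> S \<Longrightarrow> C p q = D p q"
    then show "L C j = L D j"
      by (cases j) (auto simp: L S_def J_def intro!: sum.cong)
  next
    fix j assume "j \<in> J"
    then show "continuous_on UNIV (\<lambda>C. L C j)"
      by (cases j) (simp add: L, intro continuous_intros continuous_on_kernel_entry)
  next
    fix C p assume C: "psd_kernel S C" and p: "p \<in> S"
    obtain i a where ia: "p = (i, a)" "i < d" "a < n" using p by (auto simp: S_def)
    have diag: "0 \<le> C (l, a) (l, a)" if "l < d" for l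
      by (rule psd_kernel_diag[OF C fin(1)]) (use that ia in \<open>auto simp: S_def\<close>)
    \<comment> \<open>For \<open>k = 0\<close>, the coordinate \<open>(0, a, a)\<close> sums the
      nonnegative diagonal entries with output index \<open>a\<close> and so bounds each of
      them.\<close>
    have J: "(0, a, a) \<in> J" using ia by (simp add: J_def)
    have "L C (0, a, a) = (\<Sum>l<d. C (l, a) (l, a))"
    proof -
      have "L C (0, a, a) = (\<Sum>i<d. \<Sum>j<d. if i = j then C (i, a) (j, a) else 0)"
        unfolding L[OF J] by (intro sum.cong) auto
      then show ?thesis by simp
    qed
    moreover have "cmod (C p p) = Re (C p p)"
      using diag[OF ia(2)] ia by (simp add: cmod_eq_Re less_eq_complex_def)
    moreover have "Re (C p p) \<le> (\<Sum>l<d. Re (C (l, a) (l, a)))"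
      unfolding ia(1) using ia diag
      by (intro member_le_sum[of i _ "\<lambda>l. Re (C (l, a) (l, a))"]) (auto simp: less_eq_complex_def)
    ultimately have "cmod (C p p) \<le> Re (L C (0, a, a))" by simp
    also have "\<dots> \<le> cmod (L C (0, a, a))" by (rule complex_Re_le_cmod)
    also have "\<dots> \<le> (\<Sum>j\<in>J. cmod (L C j))"
      using J fin by (intro member_le_sum) auto
    finally show "cmod (C p p) \<le> (\<Sum>j\<in>J. cmod (L C j))" .
  next
    fix R :: "int \<times> nat \<times> nat \<Rightarrow> complex"
    assume R: "\<And>D. psd_kernel S D \<Longrightarrow> 0 \<le> (\<Sum>j\<in>J. Re (cnj (R j) * L D j))"
    define Z where "Z = (\<lambda>(a, i) (b, j). cnj (R (int i - int j, a, b)))"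
    \<comment> \<open>Coefficients of the Hermitian part of \<open>Z\<close>; the hypothesis on
      \<open>R\<close> controls real parts only.\<close>
    define c where "c a b k = (cnj (R (k, a, b)) + R (- k, b, a)) / 2" for a b k
    define Y where "Y a b = mat d d (\<lambda>(i, j). c a b (int i - int j))" for a b
    have Y: "Y a b \<in> toeplitz d" for a b unfolding Y_def by (rule toeplitzI)
    have "psd_kernel ({..<n} \<times> {..<d}) (\<lambda>p q. (Z p q + cnj (Z q p)) / 2)"
      unfolding psd_kernel_def
    proof
      fix v :: "nat \<times> nat \<Rightarrow> complex"
      \<comment> \<open>A rank-one test kernel whose pairing with \<open>R\<close> is the form of
        \<open>Z\<close> at \<open>v\<close>.\<close>
      define D where "D = (\<lambda>(i, a) (j, b). cnj (v (a, i)) * v (b, j))"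
      have "psd_kernel S D"
        using psd_kernel_rank_one[of S "\<lambda>(i, a). cnj (v (a, i))"] by (simp add: D_def split_def)
      have "(\<Sum>j\<in>J. cnj (R j) * L D j) = sesq ({..<n} \<times> {..<d}) Z v v"
      proof -
        let ?F = "\<lambda>k a b i j. cnj (R (k, a, b)) * (of_bool (int i - int j = k) * (cnj (v (a, i)) * v (b, j)))"
        have "(\<Sum>j\<in>J. cnj (R j) * L D j) =
            (\<Sum>(k, a, b)\<in>J. cnj (R (k, a, b)) *
              (\<Sum>i<d. \<Sum>j<d. of_bool (int i - int j = k) * D (i, a) (j, b)))"
          by (intro sum.cong) (auto simp: L)
        also have "\<dots> = (\<Sum>k\<in>{- int d..int d}. \<Sum>a<n. \<Sum>b<n. \<Sum>i<d. \<Sum>j<d. ?F k a b i j)"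
          unfolding J_def sum.cartesian_product' split sum_distrib_left D_def by simp
        also have "\<dots> = (\<Sum>a<n. \<Sum>k\<in>{- int d..int d}. \<Sum>b<n. \<Sum>i<d. \<Sum>j<d. ?F k a b i j)"
          by (rule sum.swap)
        also have "\<dots> = (\<Sum>a<n. \<Sum>b<n. \<Sum>k\<in>{- int d..int d}. \<Sum>i<d. \<Sum>j<d. ?F k a b i j)"
          by (intro sum.cong refl sum.swap)
        also have "\<dots> = (\<Sum>a<n. \<Sum>b<n. \<Sum>i<d. \<Sum>k\<in>{- int d..int d}. \<Sum>j<d. ?F k a b i j)"
          by (intro sum.cong refl sum.swap)
        also have "\<dots> = (\<Sum>a<n. \<Sum>b<n. \<Sum>i<d. \<Sum>j<d. \<Sum>k\<in>{- int d..int d}. ?F k a b i j)"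
          by (intro sum.cong refl sum.swap)
        also have "\<dots> = (\<Sum>a<n. \<Sum>b<n. \<Sum>i<d. \<Sum>j<d. Z (a, i) (b, j) * v (b, j) * cnj (v (a, i)))"
        proof (intro sum.cong refl)
          fix a b i j assume ij: "i \<in> {..<d}" "j \<in> {..<d}"
          have "(\<Sum>k\<in>{- int d..int d}. ?F k a b i j) =
              (\<Sum>k\<in>{- int d..int d}. if int i - int j = k then cnj (R (k, a, b)) * (cnj (v (a, i)) * v (b, j)) else 0)"
            by (intro sum.cong) auto
          also have "\<dots> = Z (a, i) (b, j) * v (b, j) * cnj (v (a, i))"
            using ij by (simp add: Z_def)
          finally show "(\<Sum>k\<in>{- int d..int d}. ?F k a b i j) = Z (a, i) (b, j) * v (b, j) * cnj (v (a, i))" .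
        qed
        also have "\<dots> = (\<Sum>a<n. \<Sum>i<d. \<Sum>b<n. \<Sum>j<d. Z (a, i) (b, j) * v (b, j) * cnj (v (a, i)))"
          by (intro sum.cong refl sum.swap)
        also have "\<dots> = sesq ({..<n} \<times> {..<d}) Z v v"
          unfolding sesq_def sum.cartesian_product' by simp
        finally show ?thesis .
      qed
      then have "0 \<le> Re (sesq ({..<n} \<times> {..<d}) Z v v)"
        using R[OF \<open>psd_kernel S D\<close>] by (metis Re_sum)
      moreover have "sesq ({..<n} \<times> {..<d}) (\<lambda>p q. (Z p q + cnj (Z q p)) / 2) v v =
          Re (sesq ({..<n} \<times> {..<d}) Z v v)"
        using sesq_scale_kernel[of "{..<n} \<times> {..<d}" "1 / 2" "\<lambda>p q. Z p q + cnj (Z q p)" v v]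
        by (simp add: sesq_add_kernel sesq_adjoint complex_add_cnj)
      ultimately show "0 \<le> sesq ({..<n} \<times> {..<d}) (\<lambda>p q. (Z p q + cnj (Z q p)) / 2) v v"
        by (simp add: less_eq_complex_def)
    qed
    then have "psd_kernel ({..<n} \<times> {..<d}) (\<lambda>(a, i) (b, j). Y a b $$ (i, j))"
      by (rule psd_kernel_cong[THEN iffD1, rotated]) (auto simp: Y_def Z_def c_def)
    then have "psd_kernel ({..<n} \<times> {..<n}) (\<lambda>(a, x) (b, y). \<phi> (Y a b) $$ (x, y))"
      by (intro completely_positiveD[OF \<phi>] Y)
    \<comment> \<open>Testing at the sum of all \<open>e_a \<otimes> e_a\<close> extracts the sum of
      the entries \<open>(a, b)\<close> of \<open>\<phi> (Y a b)\<close>, which is the pairing of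
      \<open>c\<close> with \<open>f\<close>.\<close>
    from psd_kernelD[OF this, of "\<lambda>(a, x). of_bool (a = x)"]
    have "0 \<le> (\<Sum>a<n. \<Sum>x<n. \<Sum>b<n. \<Sum>y<n.
        \<phi> (Y a b) $$ (x, y) * of_bool (b = y) * cnj (of_bool (a = x)))"
      unfolding sesq_def sum.cartesian_product' by simp
    also have "\<dots> = (\<Sum>a<n. \<Sum>x<n. \<Sum>b<n. \<Sum>y<n.
        if b = y then if a = x then \<phi> (Y a b) $$ (x, y) else 0 else 0)"
      by (intro sum.cong) auto
    also have "\<dots> = (\<Sum>a<n. \<Sum>x<n. if a = x then \<Sum>b<n. \<phi> (Y a b) $$ (x, b) else 0)"
      by (intro sum.cong) auto
    also have "\<dots> = (\<Sum>a<n. \<Sum>b<n. \<phi> (Y a b) $$ (a, b))"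
      by simp
    also have "\<dots> = (\<Sum>a<n. \<Sum>b<n. \<Sum>k\<in>{- int d..int d}. c a b k * f (k, a, b))"
      unfolding Y_def linear_map_on_toeplitz[OF lin] by (simp add: f_def)
    finally have "0 \<le> Re (\<Sum>a<n. \<Sum>b<n. \<Sum>k\<in>{- int d..int d}. c a b k * f (k, a, b))"
      by (simp add: less_eq_complex_def)
    \<comment> \<open>By adjoint symmetry of \<open>\<phi>\<close> the two halves of
      \<open>c\<close> contribute conjugate sums, so symmetrizing did not change the real
      part.\<close>
    moreover have "(\<Sum>a<n. \<Sum>b<n. \<Sum>k\<in>{- int d..int d}. R (- k, b, a) * f (k, a, b)) =
        cnj (\<Sum>a<n. \<Sum>b<n. \<Sum>k\<in>{- int d..int d}. cnj (R (k, a, b)) * f (k, a, b))"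
    proof -
      have "(\<Sum>k\<in>{- int d..int d}. R (- k, b, a) * f (k, a, b)) =
          (\<Sum>k\<in>{- int d..int d}. R (k, b, a) * cnj (f (k, b, a)))" if "a < n" "b < n" for a b
      proof (rule sum.reindex_bij_witness[of _ uminus uminus])
        fix k
        show "R (- k, b, a) * cnj (f (- k, b, a)) = R (- k, b, a) * f (k, a, b)"
          using completely_positive_shift_adjoint[OF \<phi> that, of k] by (simp add: f_def)
      qed auto
      then have "(\<Sum>a<n. \<Sum>b<n. \<Sum>k\<in>{- int d..int d}. R (- k, b, a) * f (k, a, b)) =
          (\<Sum>a<n. \<Sum>b<n. \<Sum>k\<in>{- int d..int d}. R (k, b, a) * cnj (f (k, b, a)))"
        by simp
      also have "\<dots> = (\<Sum>a<n. \<Sum>b<n. \<Sum>k\<in>{- int d..int d}. R (k, a, b) * cnj (f (k, a, b)))"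
        by (rule sum.swap)
      finally show ?thesis by simp
    qed
    moreover have "(\<Sum>a<n. \<Sum>b<n. \<Sum>k\<in>{- int d..int d}. c a b k * f (k, a, b)) =
        ((\<Sum>a<n. \<Sum>b<n. \<Sum>k\<in>{- int d..int d}. cnj (R (k, a, b)) * f (k, a, b)) +
         (\<Sum>a<n. \<Sum>b<n. \<Sum>k\<in>{- int d..int d}. R (- k, b, a) * f (k, a, b))) / 2"
      by (simp add: c_def add_divide_distrib distrib_right sum.distrib sum_divide_distrib)
    ultimately have "0 \<le> Re (\<Sum>a<n. \<Sum>b<n. \<Sum>k\<in>{- int d..int d}. cnj (R (k, a, b)) * f (k, a, b))"
      by simp
    also have "(\<Sum>a<n. \<Sum>b<n. \<Sum>k\<in>{- int d..int d}. cnj (R (k, a, b)) * f (k, a, b)) =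
        (\<Sum>a<n. \<Sum>k\<in>{- int d..int d}. \<Sum>b<n. cnj (R (k, a, b)) * f (k, a, b))"
      by (intro sum.cong refl sum.swap)
    also have "\<dots> = (\<Sum>k\<in>{- int d..int d}. \<Sum>a<n. \<Sum>b<n. cnj (R (k, a, b)) * f (k, a, b))"
      by (rule sum.swap)
    also have "\<dots> = (\<Sum>j\<in>J. cnj (R j) * f j)"
      unfolding J_def sum.cartesian_product' ..
    finally show "0 \<le> (\<Sum>j\<in>J. Re (cnj (R j) * f j))" by (simp only: Re_sum)
  qed
  then obtain C where C: "psd_kernel S C" "\<And>j. j \<in> J \<Longrightarrow> L C j = f j" by blast
  have "choi_map d n C X = \<phi> X" if "X \<in> toeplitz d" for X
  proof (rule linear_map_on_toeplitz_eqI[OF _ lin _ that])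
    show "linear_map_on (toeplitz d) n (choi_map d n C)"
      by (rule choi_map_linear) (use mat_subspace_toeplitz in \<open>simp add: mat_subspace_def\<close>)
    fix k a b assume "k \<in> {- int d..int d}" "a < n" "b < n"
    then show "choi_map d n C (shift_mat d k) $$ (a, b) = \<phi> (shift_mat d k) $$ (a, b)"
      using C(2)[of "(k, a, b)"] by (simp add: J_def L_def f_def)
  qed
  then show ?thesis using that C(1) by (simp add: S_def)
qed

section \<open>Uniqueness\<close>

text \<open>The case \<open>t = 0\<close> serves for scalar multiples.\<close>

lemma choi_map_lincomb:
  assumes "\<And>p q. p \<in> {..<d} \<times> {..<n} \<Longrightarrow> q \<in> {..<d} \<times> {..<n} \<Longrightarrow> E p q = s * C p q + t * D p q"
    and "a < n" "b < n"
  shows "choi_map d n E X $$ (a, b) = s * choi_map d n C X $$ (a, b) + t * choi_map d n D X $$ (a, b)"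
  using assms by (simp add: choi_map_index distrib_left sum.distrib sum_distrib_left mult_ac)

lemma toeplitz_subset_carrier: "toeplitz d \<subseteq> carrier_mat d d"
  using mat_subspace_toeplitz by (simp add: mat_subspace_def)

text \<open>The leading term argument: the entry that pairs the last nonzero coefficient of \<open>w\<close> with the
  first nonzero coefficient of \<open>u\<close> is alone on its diagonal.\<close>

lemma choi_map_rank_one_shift_eq_0:
  assumes zero: "\<And>k a b. a < n \<Longrightarrow> b < n \<Longrightarrow>
      choi_map d n (\<lambda>p q. w p * cnj (u q)) (shift_mat d k) $$ (a, b) = 0"
    and u: "q \<in> {..<d} \<times> {..<n}" "u q \<noteq> 0" and p: "p \<in> {..<d} \<times> {..<n}"
  shows "w p = 0"
proof (rule ccontr)
  assume "w p \<noteq> 0"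
  obtain i a where ia: "p = (i, a)" "i < d" "a < n" using p by auto
  obtain j b where jb: "q = (j, b)" "j < d" "b < n" using u by auto
  define i0 where "i0 = Max {i. i < d \<and> w (i, a) \<noteq> 0}"
  define j0 where "j0 = Min {j. j < d \<and> u (j, b) \<noteq> 0}"
  have "i \<in> {i. i < d \<and> w (i, a) \<noteq> 0}" "j \<in> {j. j < d \<and> u (j, b) \<noteq> 0}"
    using ia jb u \<open>w p \<noteq> 0\<close> by auto
  then have "i0 \<in> {i. i < d \<and> w (i, a) \<noteq> 0}" "j0 \<in> {j. j < d \<and> u (j, b) \<noteq> 0}"
    unfolding i0_def j0_def by (intro Max_in Min_in; auto)+
  then have i0: "i0 < d" "w (i0, a) \<noteq> 0" and j0: "j0 < d" "u (j0, b) \<noteq> 0" by auto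
  have i0_max: "w (i, a) = 0" if "i < d" "i0 < i" for i
    using Max_ge[of "{i. i < d \<and> w (i, a) \<noteq> 0}" i] that by (auto simp: i0_def[symmetric])
  have j0_min: "u (j, b) = 0" if "j < d" "j < j0" for j
    using Min_le[of "{j. j < d \<and> u (j, b) \<noteq> 0}" j] that by (auto simp: j0_def[symmetric])
  have "0 = (\<Sum>i<d. \<Sum>j<d. of_bool (int i - int j = int i0 - int j0) * (w (i, a) * cnj (u (j, b))))"
    using zero[OF ia(3) jb(3), of "int i0 - int j0"] by (simp add: choi_map_shift ia jb)
  \<comment> \<open>On this diagonal, \<open>i > i0\<close> kills the factor from \<open>w\<close>,
    while \<open>i < i0\<close> implies \<open>j < j0\<close> and kills the factor from
    \<open>u\<close>.\<close>
  also have "\<dots> = (\<Sum>i<d. \<Sum>j<d. if j = j0 then if i = i0 then w (i, a) * cnj (u (j, b)) else 0 else 0)"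
  proof (intro sum.cong refl)
    fix i j assume "i \<in> {..<d}" "j \<in> {..<d}"
    then show "of_bool (int i - int j = int i0 - int j0) * (w (i, a) * cnj (u (j, b))) =
        (if j = j0 then if i = i0 then w (i, a) * cnj (u (j, b)) else 0 else 0)"
      using i0_max[of i] j0_min[of j] by (cases "i0 < i"; cases "j < j0") auto
  qed
  also have "\<dots> = w (i0, a) * cnj (u (j0, b))" using i0(1) j0(1) by simp
  finally show False using i0 j0 by simp
qed

text \<open>Scaled below \<open>C\<close>, the kernel \<open>D\<close> gives a map below
  \<open>\<phi>\<close>, to which purity applies. Undoing the scaling multiplies the factor, so
  \<open>t\<close> is not confined to \<open>[0, 1]\<close>.\<close>

lemma pure_cp_dominated_kernel:
  assumes \<phi>: "pure_cp d (toeplitz d) n \<phi>"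
    and C: "psd_kernel ({..<d} \<times> {..<n}) C" "\<And>X. X \<in> toeplitz d \<Longrightarrow> choi_map d n C X = \<phi> X"
    and D: "psd_kernel ({..<d} \<times> {..<n}) D"
    and le: "0 \<le> s" "psd_kernel ({..<d} \<times> {..<n}) (\<lambda>p q. complex_of_real s * C p q - D p q)"
  shows "\<exists>t :: real. \<forall>X\<in>toeplitz d. \<forall>a<n. \<forall>b<n.
    choi_map d n D X $$ (a, b) = t * \<phi> X $$ (a, b)"
proof -
  let ?S = "{..<d} \<times> {..<n}"
  \<comment> \<open>The added 1 keeps the divisor positive when \<open>s = 0\<close>; it contributes
    one more copy of \<open>C\<close> to the semidefinite difference.\<close>
  define r where "r = s + 1"
  have r: "0 < r" using le by (simp add: r_def)
  define E where "E p q = complex_of_real (1 / r) * D p q" for p q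
  define F where "F p q = C p q - E p q" for p q
  have "psd_kernel ?S E" unfolding E_def by (rule psd_kernel_scale[OF D]) (use r in simp)
  then have E: "completely_positive d (toeplitz d) n (choi_map d n E)"
    by (rule choi_map_completely_positive[OF _ toeplitz_subset_carrier])
  have "psd_kernel ?S (\<lambda>p q. complex_of_real (1 / r) * ((complex_of_real s * C p q - D p q) + C p q))"
    by (rule psd_kernel_scale[OF psd_kernel_add[OF le(2) C(1)]]) (use r in simp)
  moreover have "complex_of_real (1 / r) * ((complex_of_real s * C p q - D p q) + C p q) = F p q" for p q
  proof -
    have "(complex_of_real s * C p q - D p q) + C p q = complex_of_real r * C p q - D p q"
      by (simp add: r_def algebra_simps)
    then show ?thesis using r by (simp add: F_def E_def field_simps)
  qed
  ultimately have "psd_kernel ?S F" by simp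
  then have F: "completely_positive d (toeplitz d) n (choi_map d n F)"
    by (rule choi_map_completely_positive[OF _ toeplitz_subset_carrier])
  have "choi_map d n F X = \<phi> X - choi_map d n E X" if X: "X \<in> toeplitz d" for X
  proof (intro eq_matI)
    fix a b assume "a < dim_row (\<phi> X - choi_map d n E X)" "b < dim_col (\<phi> X - choi_map d n E X)"
    then have ab: "a < n" "b < n" by (simp_all add: choi_map_def)
    then show "choi_map d n F X $$ (a, b) = (\<phi> X - choi_map d n E X) $$ (a, b)"
      using choi_map_lincomb[of d n F 1 C "- 1" E a b X]
      by (simp add: F_def C(2)[OF X, symmetric] choi_map_def)
  qed (auto simp: choi_map_def)
  from completely_positive_cong[OF mat_subspace_toeplitz this F]
  have "cp_le d (toeplitz d) n (choi_map d n E) \<phi>" by (simp add: cp_le_def)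
  with \<phi> E obtain t :: real where
    t: "\<And>X. X \<in> toeplitz d \<Longrightarrow> choi_map d n E X = complex_of_real t \<cdot>\<^sub>m \<phi> X"
    unfolding pure_cp_def by blast
  have "choi_map d n D X $$ (a, b) = (r * t) * \<phi> X $$ (a, b)"
    if X: "X \<in> toeplitz d" and ab: "a < n" "b < n" for X a b
  proof -
    have "choi_map d n D X $$ (a, b) = r * choi_map d n E X $$ (a, b)"
      using choi_map_lincomb[of d n D r E 0 E a b X] r ab by (simp add: E_def)
    moreover have "\<phi> X \<in> carrier_mat n n" using C(2)[OF X] choi_map_carrier by metis
    ultimately show ?thesis using ab by (simp add: t[OF X])
  qed
  then show ?thesis by (intro exI[of _ "r * t"]) simp
qed

lemma pure_cp_kernel_unique:
  assumes \<phi>: "pure_cp d (toeplitz d) n \<phi>"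
    and C1: "psd_kernel ({..<d} \<times> {..<n}) C1" "\<And>X. X \<in> toeplitz d \<Longrightarrow> choi_map d n C1 X = \<phi> X"
    and C2: "psd_kernel ({..<d} \<times> {..<n}) C2" "\<And>X. X \<in> toeplitz d \<Longrightarrow> choi_map d n C2 X = \<phi> X"
    and pq: "p \<in> {..<d} \<times> {..<n}" "q \<in> {..<d} \<times> {..<n}"
  shows "C1 p q = C2 p q"
proof -
  define S where "S = {..<d} \<times> {..<n}"
  have S: "finite S" by (simp add: S_def)
  note C1 = C1[folded S_def] and C2 = C2[folded S_def]
  have lin: "linear_map_on (toeplitz d) n \<phi>" using \<phi> by (simp add: pure_cp_def completely_positive_def)
  define M where "M w u k a b = choi_map d n (\<lambda>p q. w p * cnj (u q)) (shift_mat d k) $$ (a, b)"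
    for w u k a b
  define f where "f k a b = \<phi> (shift_mat d k) $$ (a, b)" for k a b
  have f: "choi_map d n C1 (shift_mat d k) $$ (a, b) = f k a b"
    "choi_map d n C2 (shift_mat d k) $$ (a, b) = f k a b" for k a b
    by (simp_all add: f_def C1 C2 shift_mat_toeplitz)
  \<comment> \<open>A reference entry at which \<open>\<phi>\<close> does not vanish, for comparing
    scalar factors at the end.\<close>
  obtain k0 a0 b0 where f0: "f k0 a0 b0 \<noteq> 0" "a0 < n" "b0 < n"
  proof -
    have "\<exists>k a b. a < n \<and> b < n \<and> f k a b \<noteq> 0"
    proof (rule ccontr)
      assume *: "\<nexists>k a b. a < n \<and> b < n \<and> f k a b \<noteq> 0"
      have "\<phi> X = choi_map d n (\<lambda>_ _. 0) X" if "X \<in> toeplitz d" for X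
        by (rule linear_map_on_toeplitz_eqI[OF lin choi_map_linear[OF toeplitz_subset_carrier] _ that])
          (use * in \<open>auto simp: f_def choi_map_index\<close>)
      moreover have "choi_map d n (\<lambda>_ _. 0) X = 0\<^sub>m n n" for X
        by (intro eq_matI) (auto simp: choi_map_def)
      ultimately show False using \<phi> by (auto simp: pure_cp_def)
    qed
    then show ?thesis using that by blast
  qed
  \<comment> \<open>Twice the average dominates both kernels, so one space \<open>W\<close> contains
    the columns of each.\<close>
  define C where "C p q = complex_of_real (1 / 2) * (C1 p q + C2 p q)" for p q
  have C_psd: "psd_kernel S C"
    unfolding C_def by (intro psd_kernel_scale psd_kernel_add C1 C2) simp
  have C_ext: "choi_map d n C X = \<phi> X" if X: "X \<in> toeplitz d" for X
  proof (intro eq_matI)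
    have carr: "\<phi> X \<in> carrier_mat n n" using C1(2)[OF X] choi_map_carrier by metis
    then show "dim_row (choi_map d n C X) = dim_row (\<phi> X)" "dim_col (choi_map d n C X) = dim_col (\<phi> X)"
      by (auto simp: choi_map_def)
    fix a b assume "a < dim_row (\<phi> X)" "b < dim_col (\<phi> X)"
    then have "a < n" "b < n" using carr by auto
    then show "choi_map d n C X $$ (a, b) = \<phi> X $$ (a, b)"
      using choi_map_lincomb[of d n C "1 / 2" C1 "1 / 2" C2 a b X]
      by (simp add: C_def C1(2)[OF X] C2(2)[OF X] distrib_left)
  qed
  \<comment> \<open>Up to values off \<open>S\<close> this is the range of \<open>C\<close>;
    domination is the form in which purity can be applied.\<close>
  define W where "W = {w. \<exists>s\<ge>0. psd_kernel S (\<lambda>p q. complex_of_real s * C p q - w p * cnj (w q))}"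
  have W_add: "(\<lambda>p. w p + u p) \<in> W" if w: "w \<in> W" and u: "u \<in> W" for w u
  proof -
    obtain s t where s: "0 \<le> s" "psd_kernel S (\<lambda>p q. complex_of_real s * C p q - w p * cnj (w q))"
      and t: "0 \<le> t" "psd_kernel S (\<lambda>p q. complex_of_real t * C p q - u p * cnj (u q))"
      using w u by (auto simp: W_def)
    \<comment> \<open>Parallelogram identity: \<open>2 w w\<^sup>* + 2 u u\<^sup>* = (w + u) (w +
      u)\<^sup>* + (w - u) (w - u)\<^sup>*\<close>.\<close>
    have "psd_kernel S (\<lambda>p q. complex_of_real 2 * ((complex_of_real s * C p q - w p * cnj (w q)) +
        (complex_of_real t * C p q - u p * cnj (u q))) + (w p - u p) * cnj (w q - u q))"
      by (intro psd_kernel_add[OF psd_kernel_scale[OF psd_kernel_add[OF s(2) t(2)]]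
            psd_kernel_rank_one[of S "\<lambda>p. w p - u p"]]) simp
    then have "psd_kernel S (\<lambda>p q. complex_of_real (2 * s + 2 * t) * C p q - (w p + u p) * cnj (w q + u q))"
      by (simp add: algebra_simps)
    then show ?thesis using s t unfolding W_def by (intro CollectI exI[of _ "2 * s + 2 * t"]) simp
  qed
  have W_scale: "(\<lambda>p. c * w p) \<in> W" if w: "w \<in> W" for c w
  proof -
    obtain s where s: "0 \<le> s" "psd_kernel S (\<lambda>p q. complex_of_real s * C p q - w p * cnj (w q))"
      using w by (auto simp: W_def)
    have "psd_kernel S (\<lambda>p q. complex_of_real ((cmod c)\<^sup>2) * (complex_of_real s * C p q - w p * cnj (w q)))"
      by (rule psd_kernel_scale[OF s(2)]) simp
    then have "psd_kernel S (\<lambda>p q. complex_of_real ((cmod c)\<^sup>2 * s) * C p q - (c * w p) * cnj (c * w q))"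
      unfolding of_real_mult complex_norm_square by (simp add: algebra_simps)
    then show ?thesis using s unfolding W_def by (intro CollectI exI[of _ "(cmod c)\<^sup>2 * s"]) simp
  qed
  \<comment> \<open>The column is \<open>B\<close> applied to a basis vector, so
    \<open>B q q\<close> times \<open>B\<close> dominates its rank-one kernel; adding
    \<open>B q q\<close> times \<open>B'\<close> makes the bound a multiple of \<open>C\<close>. The
    pair \<open>B\<close>, \<open>B'\<close> stands for the two extensions in either order.\<close>
  have W_column: "(\<lambda>p. B p q) \<in> W" if B: "psd_kernel S B" and B': "psd_kernel S B'"
    and BC: "\<And>p q. B p q + B' p q = 2 * C p q" and q: "q \<in> S" for B B' q
  proof -
    let ?e = "\<lambda>x. of_bool (x = q) :: complex"
    have column: "(\<Sum>r\<in>S. B p r * ?e r) = B p q" for p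
      using q S by (simp add: of_bool_def if_distrib cong: if_cong)
    define s where "s = Re (B q q)"
    have s: "0 \<le> s" "B q q = complex_of_real s"
      using psd_kernel_diag[OF B S q] by (auto simp: s_def complex_eq_iff less_eq_complex_def)
    have "psd_kernel S (\<lambda>p r. (complex_of_real s * B p r - B p q * cnj (B r q)) + complex_of_real s * B' p r)"
      using psd_kernel_diff_column[OF B, of ?e] psd_kernel_scale[OF B' s(1)]
      by (intro psd_kernel_add) (simp_all add: column sesq_units S q s(2))
    moreover have "(complex_of_real s * B p r - B p q * cnj (B r q)) + complex_of_real s * B' p r =
        complex_of_real (2 * s) * C p r - B p q * cnj (B r q)" for p r
    proof -
      have "(complex_of_real s * B p r - B p q * cnj (B r q)) + complex_of_real s * B' p r =
          complex_of_real s * (B p r + B' p r) - B p q * cnj (B r q)"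
        by (simp add: algebra_simps)
      then show ?thesis by (simp add: BC)
    qed
    ultimately have "psd_kernel S (\<lambda>p r. complex_of_real (2 * s) * C p r - B p q * cnj (B r q))" by simp
    then show ?thesis using s(1) unfolding W_def by (intro CollectI exI[of _ "2 * s"]) simp
  qed
  have M_diag: "\<exists>t. \<forall>k a b. a < n \<longrightarrow> b < n \<longrightarrow> M w w k a b = t * f k a b" if w: "w \<in> W" for w
  proof -
    obtain s where s: "0 \<le> s" "psd_kernel S (\<lambda>p q. complex_of_real s * C p q - w p * cnj (w q))"
      using w by (auto simp: W_def)
    have "\<exists>t :: real. \<forall>X\<in>toeplitz d. \<forall>a<n. \<forall>b<n.
        choi_map d n (\<lambda>p q. w p * cnj (w q)) X $$ (a, b) = t * \<phi> X $$ (a, b)"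
      by (rule pure_cp_dominated_kernel[OF \<phi> C_psd[unfolded S_def] C_ext psd_kernel_rank_one s[unfolded S_def]])
    then show ?thesis using shift_mat_toeplitz unfolding M_def f_def by blast
  qed
  have M_polar: "4 * M w u k a b = M (\<lambda>p. w p + u p) (\<lambda>p. w p + u p) k a b
      - M (\<lambda>p. w p + (- 1) * u p) (\<lambda>p. w p + (- 1) * u p) k a b
      + \<i> * M (\<lambda>p. w p + \<i> * u p) (\<lambda>p. w p + \<i> * u p) k a b
      - \<i> * M (\<lambda>p. w p + (- \<i>) * u p) (\<lambda>p. w p + (- \<i>) * u p) k a b"
    if ab: "a < n" "b < n" for w u k a b
    using ab
    by (simp add: M_def choi_map_index sum_distrib_left sum.distrib[symmetric] sum_subtractf[symmetric])
      (simp add: algebra_simps)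
  have M_prop: "\<exists>t. \<forall>k a b. a < n \<longrightarrow> b < n \<longrightarrow> M w u k a b = t * f k a b"
    if w: "w \<in> W" and u: "u \<in> W" for w u
  proof -
    obtain t1 where t1: "\<forall>k a b. a < n \<longrightarrow> b < n \<longrightarrow>
        M (\<lambda>p. w p + u p) (\<lambda>p. w p + u p) k a b = t1 * f k a b"
      using M_diag[OF W_add[OF w u]] by blast
    obtain t2 where t2: "\<forall>k a b. a < n \<longrightarrow> b < n \<longrightarrow>
        M (\<lambda>p. w p + (- 1) * u p) (\<lambda>p. w p + (- 1) * u p) k a b = t2 * f k a b"
      using M_diag[OF W_add[OF w W_scale[OF u, of "- 1"]]] by blast
    obtain t3 where t3: "\<forall>k a b. a < n \<longrightarrow> b < n \<longrightarrow>
        M (\<lambda>p. w p + \<i> * u p) (\<lambda>p. w p + \<i> * u p) k a b = t3 * f k a b"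
      using M_diag[OF W_add[OF w W_scale[OF u, of "\<i>"]]] by blast
    obtain t4 where t4: "\<forall>k a b. a < n \<longrightarrow> b < n \<longrightarrow>
        M (\<lambda>p. w p + (- \<i>) * u p) (\<lambda>p. w p + (- \<i>) * u p) k a b = t4 * f k a b"
      using M_diag[OF W_add[OF w W_scale[OF u, of "- \<i>"]]] by blast
    have "M w u k a b = (t1 - t2 + \<i> * t3 - \<i> * t4) / 4 * f k a b" if ab: "a < n" "b < n" for k a b
    proof -
      have "4 * M w u k a b = (t1 - t2 + \<i> * t3 - \<i> * t4) * f k a b"
        unfolding M_polar[OF ab] using t1 t2 t3 t4 ab by (simp only: left_diff_distrib distrib_right mult.assoc)
      from arg_cong[OF this, of "\<lambda>z. z / 4"] show ?thesis by simp
    qed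
    then show ?thesis by blast
  qed
  have half: "C1 p q + C2 p q = 2 * C p q" "C2 p q + C1 p q = 2 * C p q" for p q
    by (simp_all add: C_def)
  note col1 = W_column[OF C1(1) C2(1) half(1)] and col2 = W_column[OF C2(1) C1(1) half(2)]
  obtain q0 where q0: "q0 \<in> S" "\<exists>p\<in>S. C1 p q0 \<noteq> 0"
  proof -
    have "\<exists>q\<in>S. \<exists>p\<in>S. C1 p q \<noteq> 0"
    proof (rule ccontr)
      assume "\<not> (\<exists>q\<in>S. \<exists>p\<in>S. C1 p q \<noteq> 0)"
      then have "f k0 a0 b0 = 0"
        unfolding f(1)[symmetric] choi_map_index[OF f0(2,3)] using f0
        by (intro sum.neutral ballI) (auto simp: S_def)
      then show False using f0 by simp
    qed
    then show ?thesis using that by blast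
  qed
  define u where "u p = C1 p q0" for p
  obtain p0 where p0: "p0 \<in> S" "u p0 \<noteq> 0" using q0 by (auto simp: u_def)
  have u: "u \<in> W" unfolding u_def by (rule col1[OF q0(1)])
  obtain c0 where c0: "\<And>k a b. a < n \<Longrightarrow> b < n \<Longrightarrow> M u u k a b = c0 * f k a b"
    using M_prop[OF u u] by blast
  \<comment> \<open>The leading term argument with both vectors equal to \<open>u\<close>: as
    \<open>u\<close> is nonzero, \<open>u u\<^sup>*\<close> cannot restrict to zero.\<close>
  have "c0 \<noteq> 0"
  proof
    assume "c0 = 0"
    then have "\<And>k a b. a < n \<Longrightarrow> b < n \<Longrightarrow>
        choi_map d n (\<lambda>p q. u p * cnj (u q)) (shift_mat d k) $$ (a, b) = 0"
      using c0 by (simp add: M_def)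
    from choi_map_rank_one_shift_eq_0[OF this, of p0 p0] show False using p0 by (simp add: S_def)
  qed
  have multiple: "\<exists>c. \<forall>p\<in>S. w p = c * u p" if w: "w \<in> W" for w
  proof -
    obtain c where c: "\<And>k a b. a < n \<Longrightarrow> b < n \<Longrightarrow> M w u k a b = c * f k a b"
      using M_prop[OF w u] by blast
    \<comment> \<open>The multiple of \<open>u\<close> is chosen so that \<open>v u\<^sup>*\<close>
      restricts to zero; since \<open>u\<close> is nonzero, \<open>v\<close> then vanishes on
      \<open>S\<close>.\<close>
    define v where "v p = w p - c / c0 * u p" for p
    have "choi_map d n (\<lambda>p q. v p * cnj (u q)) (shift_mat d k) $$ (a, b) = 0"
      if ab: "a < n" "b < n" for k a b
    proof -
      have "choi_map d n (\<lambda>p q. v p * cnj (u q)) (shift_mat d k) $$ (a, b) =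
          1 * M w u k a b + (- (c / c0)) * M u u k a b"
        unfolding M_def by (rule choi_map_lincomb) (use ab in \<open>auto simp: v_def algebra_simps\<close>)
      then show ?thesis using \<open>c0 \<noteq> 0\<close> by (simp add: c[OF ab] c0[OF ab])
    qed
    from choi_map_rank_one_shift_eq_0[OF this, of p0] have "\<forall>p\<in>S. v p = 0"
      using p0 by (simp add: S_def)
    then show ?thesis by (intro exI[of _ "c / c0"]) (simp add: v_def)
  qed
  \<comment> \<open>Every column is a multiple \<open>g q\<close> of \<open>u\<close>. Hermitian
    symmetry, read in row \<open>p0\<close>, makes \<open>g q\<close> proportional to
    \<open>cnj (u q)\<close>.\<close>
  have rank_one: "\<exists>c. \<forall>p\<in>S. \<forall>q\<in>S. B p q = c * (u p * cnj (u q))"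
    if B: "psd_kernel S B" and col: "\<And>q. q \<in> S \<Longrightarrow> (\<lambda>p. B p q) \<in> W" for B
  proof -
    have "\<forall>q\<in>S. \<exists>c. \<forall>p\<in>S. B p q = c * u p" using multiple[OF col] by blast
    then obtain g where g: "\<And>p q. p \<in> S \<Longrightarrow> q \<in> S \<Longrightarrow> B p q = g q * u p" by metis
    have "g q = cnj (g p0) / u p0 * cnj (u q)" if q: "q \<in> S" for q
    proof -
      have "g q * u p0 = cnj (g p0 * u q)"
        using psd_kernel_commute[OF B S q p0(1)] g[OF q p0(1)] g[OF p0(1) q] by simp
      then show ?thesis using p0(2) by (simp add: field_simps)
    qed
    then show ?thesis using g by (intro exI[of _ "cnj (g p0) / u p0"]) simp
  qed
  obtain c1 where c1: "\<forall>p\<in>S. \<forall>q\<in>S. C1 p q = c1 * (u p * cnj (u q))"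
    using rank_one[OF C1(1) col1] by blast
  obtain c2 where c2: "\<forall>p\<in>S. \<forall>q\<in>S. C2 p q = c2 * (u p * cnj (u q))"
    using rank_one[OF C2(1) col2] by blast
  \<comment> \<open>Both kernels extend \<open>\<phi>\<close>, so the nonzero reference entry
    determines \<open>c1\<close> and \<open>c2\<close> by the same equation.\<close>
  have "f k0 a0 b0 = c1 * M u u k0 a0 b0"
    using choi_map_lincomb[of d n C1 c1 "\<lambda>p q. u p * cnj (u q)" 0 C1 a0 b0 "shift_mat d k0"] c1 f0
    by (simp add: f M_def S_def)
  moreover have "f k0 a0 b0 = c2 * M u u k0 a0 b0"
    using choi_map_lincomb[of d n C2 c2 "\<lambda>p q. u p * cnj (u q)" 0 C2 a0 b0 "shift_mat d k0"] c2 f0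
    by (simp add: f M_def S_def)
  ultimately have "c1 = c2" using f0(1) by auto
  then show ?thesis using c1 c2 pq[folded S_def] by simp
qed

theorem theorem2:
  fixes d n :: nat and \<phi> :: "complex mat \<Rightarrow> complex mat"
  assumes "d \<ge> 1" and "n \<ge> 1"
    and "pure_cp d (toeplitz d) n \<phi>"
    and "\<phi> (1\<^sub>m d) = 1\<^sub>m n"
  shows "\<exists>!\<Phi>. \<Phi> \<in> extensional (carrier_mat d d) \<and>
           completely_positive d (carrier_mat d d) n \<Phi> \<and>
           (\<forall>X \<in> toeplitz d. \<Phi> X = \<phi> X)"
proof -
  have "completely_positive d (toeplitz d) n \<phi>" using assms(3) by (simp add: pure_cp_def)
  then obtain C where C: "psd_kernel ({..<d} \<times> {..<n}) C"
    "\<And>X. X \<in> toeplitz d \<Longrightarrow> choi_map d n C X = \<phi> X"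
    using completely_positive_extension_exists by blast
  show ?thesis
  proof (rule ex1I)
    \<comment> \<open>HOL functions are total, so uniqueness concerns maps with the default value
      off \<open>carrier_mat d d\<close>; \<open>restrict\<close> brings the Choi map into this
      form.\<close>
    have "completely_positive d (carrier_mat d d) n (restrict (choi_map d n C) (carrier_mat d d))"
      by (rule completely_positive_cong[OF mat_subspace_carrier _
            choi_map_completely_positive[OF C(1) order_refl]]) simp
    then show "restrict (choi_map d n C) (carrier_mat d d) \<in> extensional (carrier_mat d d) \<and>
        completely_positive d (carrier_mat d d) n (restrict (choi_map d n C) (carrier_mat d d)) \<and>
        (\<forall>X \<in> toeplitz d. restrict (choi_map d n C) (carrier_mat d d) X = \<phi> X)"
      using C(2) toeplitz_subset_carrier by auto
  next
    fix \<Phi> assume \<Phi>: "\<Phi> \<in> extensional (carrier_mat d d) \<and>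
        completely_positive d (carrier_mat d d) n \<Phi> \<and> (\<forall>X \<in> toeplitz d. \<Phi> X = \<phi> X)"
    have eq: "\<Phi> X = choi_map d n (choi_kernel d \<Phi>) X" if "X \<in> carrier_mat d d" for X
      by (rule choi_map_choi_kernel[OF _ that]) (use \<Phi> in \<open>simp add: completely_positive_def\<close>)
    have ext: "choi_map d n (choi_kernel d \<Phi>) X = \<phi> X" if "X \<in> toeplitz d" for X
      using \<Phi> eq[of X] that toeplitz_subset_carrier[of d] by auto
    have "choi_kernel d \<Phi> p q = C p q" if "p \<in> {..<d} \<times> {..<n}" "q \<in> {..<d} \<times> {..<n}" for p q
      by (rule pure_cp_kernel_unique[OF assms(3) choi_kernel_psd ext C that]) (use \<Phi> in auto)
    \<comment> \<open>\<open>choi_map\<close> reads its kernel only at the indices where the two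
      kernels are known to agree.\<close>
    then have "choi_map d n (choi_kernel d \<Phi>) X = choi_map d n C X" for X
      unfolding choi_map_def by (intro cong_mat) (auto intro!: sum.cong)
    then show "\<Phi> = restrict (choi_map d n C) (carrier_mat d d)"
      using \<Phi> eq by (intro extensionalityI[of _ "carrier_mat d d"]) auto
  qed
qed

end
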